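(* Let $(\Omega,\mathcal F)$ be a measurable space and let $\mathfrak P\subset\Delta(\mathcal F)$ be a nonempty set of probability measures. For a convex and solid set $\emptyset\neq\mathcal C\subset L^0_{\mathbf c+}$ consider the properties (BS1) $\mathcal C$ is order closed; (BS2) $\mathcal C=\{X\in L^0_{\mathbf c+}\mid \forall\,\mu\in\mathcal C^\diamond:\ \int X\,d\mu\le 1\}$; (BS3) $\mathcal C=\{X\in L^0_{\mathbf c+}\mid \forall\,\mu\in\mathcal C^\diamond\cap sca_{\mathbf c}:\ \int X\,d\mu\le 1\}$. (1) The following are equivalent: (i) $\mathfrak P$ is of class (S). (ii) For all convex and solid sets $\emptyset\ne\mathcal C\subset L^0_{\mathbf c+}$, (BS1) and (BS3) are equivalent. (2) The following are equivalent: (i) $sca_{\mathbf c}=ca_{\mathbf c}$. (ii) For all convex and solid sets $\emptyset\ne\mathcal C\subset L^0_{\mathbf c+}$, (BS1) and (BS2) are equivalent.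
   Context: $\Delta(\mathcal F)$ is the set of probability measures on $(\Omega,\mathcal F)$; $ca$ is the space of finite countably additive signed measures on $\mathcal F$, with total variation $|\mu|$. Put $\mathbf c(A)=\sup_{\mathbb P\in\mathfrak P}\mathbb P(A)$ for $A\in\mathcal F$. An event $A$ is $\mathfrak P$-polar if $\mathbf c(A)=0$; a property holds $\mathfrak P$-quasi surely (q.s.) if it holds outside a $\mathfrak P$-polar event. $L^0_{\mathbf c}$ is the vector lattice of equivalence classes, up to $\mathfrak P$-q.s. equality, of real-valued random variables on $(\Omega,\mathcal F)$, ordered by $X\preceq Y$ iff $f\le g$ $\mathfrak P$-q.s. for representatives $f\in X$, $g\in Y$. A subscript $+$ denotes the positive cone. For sets $\mathfrak S,\mathfrak T$ of (signed) measures, $\mathfrak S\ll\mathfrak T$ means that every $N\in\mathcal F$ with $\sup_{\nu\in\mathfrak T}|\nu|(N)=0$ satisfies $\sup_{\mu\in\mathfrak S}|\mu|(N)=0$; $\mathfrak S\approx\mathfrak T$ means $\mathfrak S\ll\mathfrak T$ and $\mathfrak T\ll\mathfrak S$. $ca_{\mathbf c}=\{\mu\in ca\mid \{\mu\}\ll\mathfrak P\}$, and $ca_{\mathbf c+}$ is the set of nonnegative measures in $ca_{\mathbf c}$. A measure $\mu$ on $(\Omega,\mathcal F)$ is supported if there is $S(\mu)\in\mathcal F$ with $\mu(S(\mu)^c)=0$ such that every $N\in\mathcal F$ with $\mu(N\cap S(\mu))=0$ satisfies $\mathbf c(N\cap S(\mu))=0$. A signed measure $\mu\in ca_{\mathbf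 c}$ is supported if $|\mu|$ is; $sca_{\mathbf c}$ is the set of supported $\mu\in ca_{\mathbf c}$. $\mathfrak P$ is of class (S) if there is $\mathfrak Q\subset\Delta(\mathcal F)$ with $\mathfrak Q\approx\mathfrak P$ and $\mathfrak Q\subset sca_{\mathbf c}$. A set $\mathcal C\subset L^0_{\mathbf c+}$ is solid if $X\in\mathcal C$ and $0\preceq Y\preceq X$ imply $Y\in\mathcal C$. Its polar is $\mathcal C^\diamond=\{\mu\in ca_{\mathbf c+}\mid\forall X\in\mathcal C:\ \int X\,d\mu\le1\}$. A net $(X_\alpha)_{\alpha\in I}$ in a vector lattice order converges to $X$ if there is a net $(Y_\alpha)_{\alpha\in I}$ with the same index set, decreasing with infimum $0$, such that $|X_\alpha-X|\preceq Y_\alpha$ for all $\alpha$. A set is order closed if it contains the limits of all its order convergent nets (here in $L^0_{\mathbf c}$). *)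

theory Defs
  imports "HOL-Probability.Probability"
begin

text \<open>A measurable space \<open>(\<Omega>, \<F>)\<close> is given as \<open>(space M, sets M)\<close> for some \<open>M :: 'a measure\<close>; the
  measure carried by \<open>M\<close> is never used. The set of probability measures \<open>P\<close> is a set of library
  measures on \<open>(space M, sets M)\<close>.\<close>

definition prob_measures :: "'a measure \<Rightarrow> 'a measure set" where
  "prob_measures M = {Q. prob_space Q \<and> sets Q = sets M}"

definition capacity :: "'a measure set \<Rightarrow> 'a set \<Rightarrow> ennreal" where
  "capacity P A = (SUP Q\<in>P. emeasure Q A)"

definition polar_event :: "'a measure \<Rightarrow> 'a measure set \<Rightarrow> 'a set \<Rightarrow> bool" where
  "polar_event M P N \<longleftrightarrow> N \<in> sets M \<and> capacity P N = 0"

definition quasi_surely :: "'a measure \<Rightarrow> 'a measure set \<Rightarrow> ('a \<Rightarrow> bool) \<Rightarrow> bool" where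
  "quasi_surely M P \<phi> \<longleftrightarrow> (\<exists>N. polar_event M P N \<and> (\<forall>w\<in>space M - N. \<phi> w))"


section \<open>Signed measures\<close>

text \<open>A finite signed measure is a real set function; it is normalised to vanish outside \<open>sets M\<close>, so
  that equality in \<open>ca\<close> is equality on \<open>sets M\<close>. This is also how \<^term>\<open>measure Q\<close> behaves, and
  \<open>measure Q\<close> is the member of \<open>ca\<close> corresponding to a finite library measure \<open>Q\<close>.\<close>

definition ca :: "'a measure \<Rightarrow> ('a set \<Rightarrow> real) set" where
  "ca M = {\<mu>. (\<forall>A. A \<notin> sets M \<longrightarrow> \<mu> A = 0) \<and>
    (\<forall>A :: nat \<Rightarrow> 'a set. range A \<subseteq> sets M \<longrightarrow> disjoint_family A \<longrightarrow>
      (\<lambda>i. \<mu> (A i)) sums \<mu> (\<Union>i. A i))}"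

definition total_variation :: "'a measure \<Rightarrow> ('a set \<Rightarrow> real) \<Rightarrow> 'a set \<Rightarrow> ennreal" where
  "total_variation M \<mu> A =
    (SUP D\<in>{D. finite D \<and> D \<subseteq> sets M \<and> partition_on A D}. \<Sum>B\<in>D. ennreal \<bar>\<mu> B\<bar>)"

definition abs_cont :: "'a measure \<Rightarrow> ('a set \<Rightarrow> real) set \<Rightarrow> ('a set \<Rightarrow> real) set \<Rightarrow> bool" where
  "abs_cont M S T \<longleftrightarrow> (\<forall>N\<in>sets M.
    (SUP \<nu>\<in>T. total_variation M \<nu> N) = 0 \<longrightarrow> (SUP \<mu>\<in>S. total_variation M \<mu> N) = 0)"

definition equiv_cont :: "'a measure \<Rightarrow> ('a set \<Rightarrow> real) set \<Rightarrow> ('a set \<Rightarrow> real) set \<Rightarrow> bool" where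
  "equiv_cont M S T \<longleftrightarrow> abs_cont M S T \<and> abs_cont M T S"

definition ca_c :: "'a measure \<Rightarrow> 'a measure set \<Rightarrow> ('a set \<Rightarrow> real) set" where
  "ca_c M P = {\<mu>\<in>ca M. abs_cont M {\<mu>} (measure ` P)}"

definition ca_c_pos :: "'a measure \<Rightarrow> 'a measure set \<Rightarrow> ('a set \<Rightarrow> real) set" where
  "ca_c_pos M P = {\<mu>\<in>ca_c M P. \<forall>A\<in>sets M. 0 \<le> \<mu> A}"

text \<open>Here \<open>m\<close> is a nonnegative measure, given by its values on \<open>sets M\<close>.\<close>

definition supported :: "'a measure \<Rightarrow> 'a measure set \<Rightarrow> ('a set \<Rightarrow> ennreal) \<Rightarrow> bool" where
  "supported M P m \<longleftrightarrow> (\<exists>S\<in>sets M. m (space M - S) = 0 \<and>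
    (\<forall>N\<in>sets M. m (N \<inter> S) = 0 \<longrightarrow> capacity P (N \<inter> S) = 0))"

definition sca_c :: "'a measure \<Rightarrow> 'a measure set \<Rightarrow> ('a set \<Rightarrow> real) set" where
  "sca_c M P = {\<mu>\<in>ca_c M P. supported M P (total_variation M \<mu>)}"

definition class_S :: "'a measure \<Rightarrow> 'a measure set \<Rightarrow> bool" where
  "class_S M P \<longleftrightarrow> (\<exists>Q \<subseteq> prob_measures M.
    equiv_cont M (measure ` Q) (measure ` P) \<and> measure ` Q \<subseteq> sca_c M P)"


section \<open>The vector lattice of random variables modulo quasi-sure equality\<close>

definition qs_rel :: "'a measure \<Rightarrow> 'a measure set \<Rightarrow> (('a \<Rightarrow> real) \<times> ('a \<Rightarrow> real)) set" where
  "qs_rel M P = {(f, g). f \<in> borel_measurable M \<and> g \<in> borel_measurable M \<and>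
    quasi_surely M P (\<lambda>w. f w = g w)}"

definition L0 :: "'a measure \<Rightarrow> 'a measure set \<Rightarrow> ('a \<Rightarrow> real) set set" where
  "L0 M P = borel_measurable M // qs_rel M P"

definition L0_class :: "'a measure \<Rightarrow> 'a measure set \<Rightarrow> ('a \<Rightarrow> real) \<Rightarrow> ('a \<Rightarrow> real) set" where
  "L0_class M P f = qs_rel M P `` {f}"

text \<open>Operations are lifted from representatives as in \<^theory>\<open>HOL.Equiv_Relations\<close>: the unions below
  are over families that are constant on \<open>L0\<close>.\<close>

definition L0_zero :: "'a measure \<Rightarrow> 'a measure set \<Rightarrow> ('a \<Rightarrow> real) set" where
  "L0_zero M P = L0_class M P (\<lambda>w. 0)"

definition L0_add :: "'a measure \<Rightarrow> 'a measure set \<Rightarrow>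
    ('a \<Rightarrow> real) set \<Rightarrow> ('a \<Rightarrow> real) set \<Rightarrow> ('a \<Rightarrow> real) set" where
  "L0_add M P X Y = (\<Union>f\<in>X. \<Union>g\<in>Y. L0_class M P (\<lambda>w. f w + g w))"

definition L0_scale :: "'a measure \<Rightarrow> 'a measure set \<Rightarrow>
    real \<Rightarrow> ('a \<Rightarrow> real) set \<Rightarrow> ('a \<Rightarrow> real) set" where
  "L0_scale M P c X = (\<Union>f\<in>X. L0_class M P (\<lambda>w. c * f w))"

definition L0_diff :: "'a measure \<Rightarrow> 'a measure set \<Rightarrow>
    ('a \<Rightarrow> real) set \<Rightarrow> ('a \<Rightarrow> real) set \<Rightarrow> ('a \<Rightarrow> real) set" where
  "L0_diff M P X Y = L0_add M P X (L0_scale M P (-1) Y)"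

definition L0_abs :: "'a measure \<Rightarrow> 'a measure set \<Rightarrow> ('a \<Rightarrow> real) set \<Rightarrow> ('a \<Rightarrow> real) set" where
  "L0_abs M P X = (\<Union>f\<in>X. L0_class M P (\<lambda>w. \<bar>f w\<bar>))"

definition L0_le :: "'a measure \<Rightarrow> 'a measure set \<Rightarrow>
    ('a \<Rightarrow> real) set \<Rightarrow> ('a \<Rightarrow> real) set \<Rightarrow> bool" where
  "L0_le M P X Y \<longleftrightarrow> (\<exists>f\<in>X. \<exists>g\<in>Y. quasi_surely M P (\<lambda>w. f w \<le> g w))"

definition L0_pos :: "'a measure \<Rightarrow> 'a measure set \<Rightarrow> ('a \<Rightarrow> real) set set" where
  "L0_pos M P = {X\<in>L0 M P. L0_le M P (L0_zero M P) X}"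

definition L0_convex :: "'a measure \<Rightarrow> 'a measure set \<Rightarrow> ('a \<Rightarrow> real) set set \<Rightarrow> bool" where
  "L0_convex M P C \<longleftrightarrow> (\<forall>X\<in>C. \<forall>Y\<in>C. \<forall>t::real. 0 \<le> t \<longrightarrow> t \<le> 1 \<longrightarrow>
    L0_add M P (L0_scale M P t X) (L0_scale M P (1 - t) Y) \<in> C)"

definition L0_solid :: "'a measure \<Rightarrow> 'a measure set \<Rightarrow> ('a \<Rightarrow> real) set set \<Rightarrow> bool" where
  "L0_solid M P C \<longleftrightarrow> (\<forall>X\<in>C. \<forall>Y\<in>L0 M P.
    L0_le M P (L0_zero M P) Y \<longrightarrow> L0_le M P Y X \<longrightarrow> Y \<in> C)"


section \<open>Order convergence\<close>

definition directed_set :: "'i set \<Rightarrow> ('i \<times> 'i) set \<Rightarrow> bool" where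
  "directed_set I r \<longleftrightarrow> I \<noteq> {} \<and> preorder_on I r \<and>
    (\<forall>a\<in>I. \<forall>b\<in>I. \<exists>c\<in>I. (a, c) \<in> r \<and> (b, c) \<in> r)"

definition decreases_to_zero :: "'a measure \<Rightarrow> 'a measure set \<Rightarrow> 'i set \<Rightarrow> ('i \<times> 'i) set \<Rightarrow>
    ('i \<Rightarrow> ('a \<Rightarrow> real) set) \<Rightarrow> bool" where
  "decreases_to_zero M P I r Y \<longleftrightarrow>
    (\<forall>a\<in>I. Y a \<in> L0 M P) \<and>
    (\<forall>(a, b)\<in>r. L0_le M P (Y b) (Y a)) \<and>
    (\<forall>a\<in>I. L0_le M P (L0_zero M P) (Y a)) \<and>
    (\<forall>Z\<in>L0 M P. (\<forall>a\<in>I. L0_le M P Z (Y a)) \<longrightarrow> L0_le M P Z (L0_zero M P))"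

definition order_converges :: "'a measure \<Rightarrow> 'a measure set \<Rightarrow> 'i set \<Rightarrow> ('i \<times> 'i) set \<Rightarrow>
    ('i \<Rightarrow> ('a \<Rightarrow> real) set) \<Rightarrow> ('a \<Rightarrow> real) set \<Rightarrow> bool" where
  "order_converges M P I r X L \<longleftrightarrow>
    (\<forall>a\<in>I. X a \<in> L0 M P) \<and> L \<in> L0 M P \<and>
    (\<exists>Y. decreases_to_zero M P I r Y \<and>
      (\<forall>a\<in>I. L0_le M P (L0_abs M P (L0_diff M P (X a) L)) (Y a)))"

text \<open>HOL cannot quantify over the type of the index set. The index type used here is that of the
  elements of \<open>L0\<close> itself; lemma \<open>order_closedD\<close> below shows that an order closed set in this sense
  contains the limits of its order convergent nets over index sets of every type.\<close>

definition order_closed :: "'a measure \<Rightarrow> 'a measure set \<Rightarrow> ('a \<Rightarrow> real) set set \<Rightarrow> bool" where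
  "order_closed M P C \<longleftrightarrow> (\<forall>(I :: ('a \<Rightarrow> real) set set) r X L.
    directed_set I r \<longrightarrow> (\<forall>a\<in>I. X a \<in> C) \<longrightarrow> order_converges M P I r X L \<longrightarrow> L \<in> C)"

lemma polar_event_Un:
  assumes "P \<subseteq> prob_measures M" "polar_event M P A" "polar_event M P B"
  shows "polar_event M P (A \<union> B)"
proof -
  have "emeasure Q (A \<union> B) = 0" if "Q \<in> P" for Q
  proof -
    have "A \<in> null_sets Q" "B \<in> null_sets Q"
      using assms that
      by (auto simp: polar_event_def capacity_def prob_measures_def null_sets_def
          SUP_eq_iff simp flip: bot_ennreal)
    then show ?thesis
      using null_sets.Un[of A Q B] by auto
  qed
  then have "capacity P (A \<union> B) = 0"
    by (cases "P = {}") (simp_all add: capacity_def bot_ennreal)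
  then show ?thesis
    using assms by (auto simp: polar_event_def)
qed

lemma quasi_surely_mp2:
  assumes "P \<subseteq> prob_measures M" "quasi_surely M P \<phi>" "quasi_surely M P \<psi>"
    and "\<And>w. \<phi> w \<Longrightarrow> \<psi> w \<Longrightarrow> \<theta> w"
  shows "quasi_surely M P \<theta>"
proof -
  obtain A B where A: "polar_event M P A" "\<forall>w\<in>space M - A. \<phi> w"
    and B: "polar_event M P B" "\<forall>w\<in>space M - B. \<psi> w"
    using assms(2,3) unfolding quasi_surely_def by blast
  have "polar_event M P (A \<union> B)"
    using assms(1) A(1) B(1) by (rule polar_event_Un)
  with A(2) B(2) assms(4) show ?thesis
    unfolding quasi_surely_def by blast
qed

lemma quasi_surelyI: "(\<And>w. \<phi> w) \<Longrightarrow> quasi_surely M P \<phi>"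
  unfolding quasi_surely_def
  by (intro exI[of _ "{}"]) (cases "P = {}", auto simp: polar_event_def capacity_def bot_ennreal)

lemma equiv_qs_rel:
  assumes "P \<subseteq> prob_measures M"
  shows "equiv (borel_measurable M) (qs_rel M P)"
proof (rule equivI)
  show "refl_on (borel_measurable M) (qs_rel M P)"
    by (auto simp: refl_on_def qs_rel_def intro: quasi_surelyI)
  show "sym (qs_rel M P)"
    by (auto simp: sym_def qs_rel_def eq_commute)
  show "trans (qs_rel M P)"
    by (auto simp: trans_def qs_rel_def elim: quasi_surely_mp2[OF assms])
qed (auto simp: qs_rel_def)

lemma L0_rep:
  assumes "X \<in> L0 M P"
  obtains f where "f \<in> borel_measurable M" "X = L0_class M P f"
  using assms unfolding L0_def L0_class_def by (auto elim: quotientE)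

lemma L0_class_iff:
  "g \<in> L0_class M P f \<longleftrightarrow>
    f \<in> borel_measurable M \<and> g \<in> borel_measurable M \<and> quasi_surely M P (\<lambda>w. f w = g w)"
  by (simp add: L0_class_def qs_rel_def)

lemma L0_class_self: "f \<in> borel_measurable M \<Longrightarrow> f \<in> L0_class M P f"
  by (simp add: L0_class_iff quasi_surelyI)

lemma L0_class_eqI:
  assumes "P \<subseteq> prob_measures M" "f \<in> borel_measurable M" "g \<in> borel_measurable M"
    and "quasi_surely M P (\<lambda>w. f w = g w)"
  shows "L0_class M P f = L0_class M P g"
  unfolding L0_class_def
  by (rule equiv_class_eq[OF equiv_qs_rel[OF assms(1)]]) (use assms in \<open>simp add: qs_rel_def\<close>)

lemma L0_le_class:
  assumes P: "P \<subseteq> prob_measures M" and [measurable]: "f \<in> borel_measurable M" "g \<in> borel_measurable M"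
  shows "L0_le M P (L0_class M P f) (L0_class M P g) \<longleftrightarrow> quasi_surely M P (\<lambda>w. f w \<le> g w)"
proof
  assume "L0_le M P (L0_class M P f) (L0_class M P g)"
  then obtain f' g' where "quasi_surely M P (\<lambda>w. f w = f' w)" "quasi_surely M P (\<lambda>w. g w = g' w)"
    "quasi_surely M P (\<lambda>w. f' w \<le> g' w)"
    by (auto simp: L0_le_def L0_class_iff)
  then have "quasi_surely M P (\<lambda>w. f w \<le> g' w)" "quasi_surely M P (\<lambda>w. g w = g' w)"
    by (auto elim: quasi_surely_mp2[OF P])
  then show "quasi_surely M P (\<lambda>w. f w \<le> g w)"
    by (auto elim: quasi_surely_mp2[OF P])
qed (use L0_class_self[OF assms(2), of P] L0_class_self[OF assms(3), of P] in \<open>auto simp: L0_le_def\<close>)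

lemma L0_le_refl: "X \<in> L0 M P \<Longrightarrow> L0_le M P X X"
  by (erule L0_rep) (auto simp: L0_le_def intro: L0_class_self quasi_surelyI)

lemma L0_le_trans:
  assumes P: "P \<subseteq> prob_measures M" and "X \<in> L0 M P" "Y \<in> L0 M P" "Z \<in> L0 M P"
    and "L0_le M P X Y" "L0_le M P Y Z"
  shows "L0_le M P X Z"
proof -
  obtain f g h where "f \<in> borel_measurable M" "X = L0_class M P f"
    "g \<in> borel_measurable M" "Y = L0_class M P g" "h \<in> borel_measurable M" "Z = L0_class M P h"
    using assms(2-4) by (meson L0_rep)
  with assms(5,6) show ?thesis
    by (auto simp: L0_le_class[OF P] elim: quasi_surely_mp2[OF P])
qed

lemma L0_add_class:
  assumes P: "P \<subseteq> prob_measures M" and [measurable]: "f \<in> borel_measurable M" "g \<in> borel_measurable M"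
  shows "L0_add M P (L0_class M P f) (L0_class M P g) = L0_class M P (\<lambda>w. f w + g w)"
proof -
  have "L0_class M P (\<lambda>w. f' w + g' w) = L0_class M P (\<lambda>w. f w + g w)"
    if "f' \<in> L0_class M P f" "g' \<in> L0_class M P g" for f' g'
    using that unfolding L0_class_iff
    by (intro L0_class_eqI[OF P]) (auto elim: quasi_surely_mp2[OF P])
  then show ?thesis
    using L0_class_self[OF assms(2), of P] L0_class_self[OF assms(3), of P]
    unfolding L0_add_def by blast
qed

lemma L0_scale_class:
  assumes P: "P \<subseteq> prob_measures M" and [measurable]: "f \<in> borel_measurable M"
  shows "L0_scale M P c (L0_class M P f) = L0_class M P (\<lambda>w. c * f w)"
proof -
  have "L0_class M P (\<lambda>w. c * f' w) = L0_class M P (\<lambda>w. c * f w)"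
    if "f' \<in> L0_class M P f" for f'
    using that unfolding L0_class_iff
    by (intro L0_class_eqI[OF P]) (auto elim: quasi_surely_mp2[OF P _ quasi_surelyI[of "\<lambda>_. True"]])
  then show ?thesis
    using L0_class_self[OF assms(2), of P] unfolding L0_scale_def by blast
qed

lemma L0_abs_class:
  assumes P: "P \<subseteq> prob_measures M" and [measurable]: "f \<in> borel_measurable M"
  shows "L0_abs M P (L0_class M P f) = L0_class M P (\<lambda>w. \<bar>f w\<bar>)"
proof -
  have "L0_class M P (\<lambda>w. \<bar>f' w\<bar>) = L0_class M P (\<lambda>w. \<bar>f w\<bar>)"
    if "f' \<in> L0_class M P f" for f'
    using that unfolding L0_class_iff
    by (intro L0_class_eqI[OF P]) (auto elim: quasi_surely_mp2[OF P _ quasi_surelyI[of "\<lambda>_. True"]])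
  then show ?thesis
    using L0_class_self[OF assms(2), of P] unfolding L0_abs_def by blast
qed

text \<open>\<open>L0_abs\<close> is the modulus \<open>X \<or> (-X)\<close> of the vector lattice.\<close>

lemma L0_abs_le_iff:
  assumes P: "P \<subseteq> prob_measures M" and "X \<in> L0 M P" "Z \<in> L0 M P"
  shows "L0_le M P (L0_abs M P X) Z \<longleftrightarrow> L0_le M P X Z \<and> L0_le M P (L0_scale M P (-1) X) Z"
proof -
  obtain f h where [measurable]: "f \<in> borel_measurable M" "h \<in> borel_measurable M"
    and eq: "X = L0_class M P f" "Z = L0_class M P h"
    using assms(2,3) by (meson L0_rep)
  have "quasi_surely M P (\<lambda>w. \<bar>f w\<bar> \<le> h w) \<longleftrightarrow>
    quasi_surely M P (\<lambda>w. f w \<le> h w) \<and> quasi_surely M P (\<lambda>w. - f w \<le> h w)"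
    by (auto elim: quasi_surely_mp2[OF P] quasi_surely_mp2[OF P _ quasi_surelyI[of "\<lambda>_. True"]])
  then show ?thesis
    by (simp add: eq L0_abs_class[OF P] L0_scale_class[OF P] L0_le_class[OF P])
qed

lemma order_closedD:
  fixes I :: "'i set"
  assumes P: "P \<subseteq> prob_measures M"
    and closed: "order_closed M P C" and dir: "directed_set I r"
    and XC: "\<And>a. a \<in> I \<Longrightarrow> X a \<in> C" and conv: "order_converges M P I r X L"
  shows "L \<in> C"
proof -
  obtain Y where Y: "decreases_to_zero M P I r Y"
    and le: "\<And>a. a \<in> I \<Longrightarrow> L0_le M P (L0_abs M P (L0_diff M P (X a) L)) (Y a)"
    using conv by (auto simp: order_converges_def)
  define J where "J = Y ` I"
  define k where "k = inv_into I Y"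
  define s where "s = {(y, z). y \<in> J \<and> z \<in> J \<and> L0_le M P z y}"
  have k: "k y \<in> I" "Y (k y) = y" if "y \<in> J" for y
    using that unfolding J_def k_def by (simp_all add: inv_into_into f_inv_into_f)
  have J: "J \<subseteq> L0 M P"
    using Y by (auto simp: J_def decreases_to_zero_def)
  have pre: "preorder_on J s"
    unfolding preorder_on_def s_def using J
    by (auto simp: refl_on_def trans_def intro: L0_le_refl L0_le_trans[OF P])
  have "directed_set J s"
    unfolding directed_set_def
  proof (intro conjI ballI pre)
    show "J \<noteq> {}"
      using dir by (auto simp: J_def directed_set_def)
    fix x y assume "x \<in> J" "y \<in> J"
    then obtain a b where ab: "a \<in> I" "b \<in> I" "x = Y a" "y = Y b"
      by (auto simp: J_def)
    then obtain c where c: "c \<in> I" "(a, c) \<in> r" "(b, c) \<in> r"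
      using dir by (auto simp: directed_set_def)
    with Y ab have "(x, Y c) \<in> s" "(y, Y c) \<in> s"
      by (auto simp: s_def J_def decreases_to_zero_def)
    with c show "\<exists>z\<in>J. (x, z) \<in> s \<and> (y, z) \<in> s"
      by (auto simp: J_def)
  qed
  moreover have "order_converges M P J s (\<lambda>y. X (k y)) L"
  proof -
    have "decreases_to_zero M P J s (\<lambda>y. y)"
      using Y by (auto simp: decreases_to_zero_def s_def J_def)
    moreover have "L0_le M P (L0_abs M P (L0_diff M P (X (k y)) L)) y" if "y \<in> J" for y
      using le[OF k(1)[OF that]] k(2)[OF that] by simp
    ultimately show ?thesis
      using conv k(1) unfolding order_converges_def by blast
  qed
  moreover have "\<forall>y\<in>J. X (k y) \<in> C"
    using k(1) XC by simp
  ultimately show ?thesis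
    using closed[unfolded order_closed_def, rule_format, of J s "\<lambda>y. X (k y)" L] by simp
qed


section \<open>Integrals and polars\<close>

definition ca_measure :: "'a measure \<Rightarrow> ('a set \<Rightarrow> real) \<Rightarrow> 'a measure" where
  "ca_measure M \<mu> = measure_of (space M) (sets M) (\<lambda>A. ennreal (\<mu> A))"

text \<open>Only used for \<open>X\<close> in \<open>L0_pos\<close> and \<open>\<mu>\<close> in \<open>ca_c_pos\<close>. The integral may be infinite. Negative
  values of a representative, which occur on a polar and hence \<open>\<mu>\<close>-null event only, are cut off by
  \<open>ennreal\<close>; the choice of the representative does not matter, see \<open>L0_integral_class\<close>.\<close>

definition L0_integral :: "'a measure \<Rightarrow> ('a set \<Rightarrow> real) \<Rightarrow> ('a \<Rightarrow> real) set \<Rightarrow> ennreal" where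
  "L0_integral M \<mu> X = (\<integral>\<^sup>+ w. ennreal ((SOME f. f \<in> X) w) \<partial>ca_measure M \<mu>)"

lemma sets_ca_measure [simp]: "sets (ca_measure M \<mu>) = sets M"
  by (simp add: ca_measure_def)

lemma ca_empty:
  assumes "\<mu> \<in> ca M"
  shows "\<mu> {} = 0"
proof -
  have "(\<lambda>i::nat. \<mu> {}) sums \<mu> (\<Union>i::nat. {})"
    using assms by (auto simp: ca_def disjoint_family_on_def dest!: spec[of _ "\<lambda>_. {}"])
  then show ?thesis
    using summable_LIMSEQ_zero[of "\<lambda>i::nat. \<mu> {}"] by (auto simp: sums_iff LIMSEQ_const_iff)
qed

lemma measure_in_ca:
  assumes "Q \<in> prob_measures M"
  shows "measure Q \<in> ca M"
proof -
  interpret prob_space Q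
    using assms by (simp add: prob_measures_def)
  have "sets Q = sets M"
    using assms by (simp add: prob_measures_def)
  then show ?thesis
    using finite_measure_UNION by (auto simp: ca_def measure_notin_sets)
qed

lemma emeasure_ca_measure:
  assumes "\<mu> \<in> ca M" "\<forall>A\<in>sets M. 0 \<le> \<mu> A" "A \<in> sets M"
  shows "emeasure (ca_measure M \<mu>) A = ennreal (\<mu> A)"
proof (rule emeasure_measure_of[OF ca_measure_def])
  have sums: "(\<lambda>i. \<mu> (B i)) sums \<mu> (\<Union>i. B i)"
    if "range B \<subseteq> sets M" "disjoint_family B" for B :: "nat \<Rightarrow> 'a set"
    using assms(1) that by (simp add: ca_def)
  show "positive (sets (ca_measure M \<mu>)) (\<lambda>A. ennreal (\<mu> A))"
    by (simp add: positive_def ca_empty[OF assms(1)])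
  show "countably_additive (sets (ca_measure M \<mu>)) (\<lambda>A. ennreal (\<mu> A))"
  proof (rule countably_additiveI)
    fix B :: "nat \<Rightarrow> 'a set"
    assume "range B \<subseteq> sets (ca_measure M \<mu>)" "disjoint_family B"
    then show "(\<Sum>i. ennreal (\<mu> (B i))) = ennreal (\<mu> (\<Union>i. B i))"
      using sums[of B] assms(2) by (intro suminf_ennreal_eq) auto
  qed
qed (use assms(3) sets.space_closed in auto)

lemma total_variation_measure:
  assumes "Q \<in> prob_measures M" "A \<in> sets M"
  shows "total_variation M (measure Q) A = emeasure Q A"
proof -
  interpret prob_space Q
    using assms(1) by (simp add: prob_measures_def)
  have [simp]: "sets Q = sets M"
    using assms(1) by (simp add: prob_measures_def)
  have *: "(\<Sum>B\<in>D. ennreal \<bar>measure Q B\<bar>) = emeasure Q A"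
    if "finite D" "D \<subseteq> sets M" "partition_on A D" for D
  proof -
    have "(\<Sum>B\<in>D. ennreal \<bar>measure Q B\<bar>) = (\<Sum>B\<in>D. emeasure Q B)"
      by (simp add: emeasure_eq_measure)
    also have "\<dots> = emeasure Q (\<Union>B\<in>D. B)"
      using that
      by (intro sum_emeasure) (auto simp: partition_on_def disjoint_def disjoint_family_on_def)
    finally show ?thesis
      using that by (simp add: partition_on_def)
  qed
  have "(if A = {} then {} else {A}) \<in> {D. finite D \<and> D \<subseteq> sets M \<and> partition_on A D}"
    using assms(2) by (auto simp: partition_on_def disjoint_def)
  then have "{D. finite D \<and> D \<subseteq> sets M \<and> partition_on A D} \<noteq> {}"
    by blast
  then show ?thesis
    using * unfolding total_variation_def by (simp cong: SUP_cong_simp)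
qed

lemma ca_c_pos_null:
  assumes P: "P \<subseteq> prob_measures M" and \<mu>: "\<mu> \<in> ca_c_pos M P" and N: "polar_event M P N"
  shows "N \<in> null_sets (ca_measure M \<mu>)"
proof -
  have NM: "N \<in> sets M"
    using N by (simp add: polar_event_def)
  have "(SUP \<nu>\<in>measure ` P. total_variation M \<nu> N) = capacity P N"
    unfolding capacity_def image_image
    by (intro SUP_cong refl total_variation_measure) (use P NM in auto)
  then have tv: "total_variation M \<mu> N = 0"
    using \<mu> N NM by (auto simp: ca_c_pos_def ca_c_def abs_cont_def polar_event_def)
  have "\<mu> N = 0"
  proof (cases "N = {}")
    case True
    then show ?thesis
      using \<mu> ca_empty by (auto simp: ca_c_pos_def ca_c_def)
  next
    case False
    then have "ennreal \<bar>\<mu> N\<bar> \<le> total_variation M \<mu> N"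
      unfolding total_variation_def
      by (intro SUP_upper2[of "{N}"]) (use NM in \<open>auto simp: partition_on_def disjoint_def\<close>)
    then show ?thesis
      using tv by simp
  qed
  then show ?thesis
    using \<mu> NM emeasure_ca_measure[of \<mu> M N] by (simp add: null_sets_def ca_c_pos_def ca_c_def)
qed

lemma L0_integral_class:
  assumes P: "P \<subseteq> prob_measures M" and \<mu>: "\<mu> \<in> ca_c_pos M P" and f: "f \<in> borel_measurable M"
  shows "L0_integral M \<mu> (L0_class M P f) = (\<integral>\<^sup>+ w. ennreal (f w) \<partial>ca_measure M \<mu>)"
proof -
  define g where "g = (SOME g. g \<in> L0_class M P f)"
  have "g \<in> L0_class M P f"
    unfolding g_def using L0_class_self[OF f, of P] by (rule someI[of "\<lambda>g. g \<in> L0_class M P f"])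
  then obtain N where N: "polar_event M P N" "\<forall>w\<in>space M - N. f w = g w"
    unfolding L0_class_iff quasi_surely_def by blast
  have "AE w in ca_measure M \<mu>. g w = f w"
    using N(2) sets_eq_imp_space_eq[OF sets_ca_measure[of M \<mu>]]
    by (intro AE_I'[OF ca_c_pos_null[OF P \<mu> N(1)]]) (auto, metis DiffI)
  then show ?thesis
    unfolding L0_integral_def g_def[symmetric] by (intro nn_integral_cong_AE) auto
qed

definition polar :: "'a measure \<Rightarrow> 'a measure set \<Rightarrow> ('a \<Rightarrow> real) set set \<Rightarrow> ('a set \<Rightarrow> real) set" where
  "polar M P C = {\<mu>\<in>ca_c_pos M P. \<forall>X\<in>C. L0_integral M \<mu> X \<le> 1}"

definition BS1 :: "'a measure \<Rightarrow> 'a measure set \<Rightarrow> ('a \<Rightarrow> real) set set \<Rightarrow> bool" where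
  "BS1 M P C \<longleftrightarrow> order_closed M P C"

definition BS2 :: "'a measure \<Rightarrow> 'a measure set \<Rightarrow> ('a \<Rightarrow> real) set set \<Rightarrow> bool" where
  "BS2 M P C \<longleftrightarrow> C = {X\<in>L0_pos M P. \<forall>\<mu>\<in>polar M P C. L0_integral M \<mu> X \<le> 1}"

definition BS3 :: "'a measure \<Rightarrow> 'a measure set \<Rightarrow> ('a \<Rightarrow> real) set set \<Rightarrow> bool" where
  "BS3 M P C \<longleftrightarrow> C = {X\<in>L0_pos M P. \<forall>\<mu>\<in>polar M P C \<inter> sca_c M P. L0_integral M \<mu> X \<le> 1}"

end

theory Submission
  imports Defs
begin

text \<open>A supported measure \<open>m\<close> turns \<open>m\<close>-a.e. statements on its support \<open>S\<close> into quasi-sure ones. Hence a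
  net decreasing to \<open>0\<close> in \<open>L0\<close> also has essential infimum \<open>0\<close> under \<open>m\<close>, so integral constraints
  given by supported measures define order closed sets: (BS3) always implies (BS1).

  Conversely, if \<open>\<C>\<close> is order closed and \<open>m\<close> is supported, then the restriction of \<open>\<C>\<close> to \<open>S\<close> is
  closed under \<open>m\<close>-a.e. convergence, since \<open>inf\<^bsub>k\<ge>n\<^esub> f\<^sub>k\<close> increases to the limit and stays in \<open>\<C>\<close> by
  solidity. The bipolar theorem of Brannath and Schachermayer in \<open>L\<^sup>0\<^sub>+(m)\<close> then separates; for a bounded
  point \<open>x\<close> it reduces to minimising \<open>\<integral> (x - f)\<^sup>2 dm\<close>. Under class (S) a point of \<open>L0\<close> is the supremum
  of its restrictions to the supports, which are directed upwards.

  For \<open>\<C> = {0}\<close>, (BS3) says that the supported measures detect every non-polar event, which is class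
  (S). For the unit ball \<open>\<C> = {X. \<integral> X dm \<le> 1}\<close>, which satisfies (BS2), order closedness forces some
  non-polar event to have only polar \<open>m\<close>-null subevents: otherwise the multiples \<open>K 1\<^sub>B\<close> with
  \<open>m B = 0\<close> would increase to the constant \<open>K\<close>. Exhausting \<open>m\<close> by such events gives a support.\<close>


section \<open>Hahn decomposition of signed measures\<close>

lemma ca_sums:
  assumes "\<mu> \<in> ca M" "range A \<subseteq> sets M" "disjoint_family A"
  shows "(\<lambda>i::nat. \<mu> (A i)) sums \<mu> (\<Union>i. A i)"
  using assms by (simp add: ca_def)

lemma ca_Un:
  assumes "\<mu> \<in> ca M" "A \<in> sets M" "B \<in> sets M" "A \<inter> B = {}"
  shows "\<mu> (A \<union> B) = \<mu> A + \<mu> B"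
proof -
  have "(\<lambda>i. \<mu> (binaryset A B i)) sums (\<mu> A + \<mu> B)"
    using sums_finite[of "{0, 1}" "\<lambda>i. \<mu> (binaryset A B i)"] ca_empty[OF assms(1)]
    by (auto simp: binaryset_def)
  moreover have "(\<lambda>i. \<mu> (binaryset A B i)) sums \<mu> (\<Union>i. binaryset A B i)"
    using assms by (intro ca_sums) (auto simp: binaryset_def disjoint_family_on_def)
  ultimately show ?thesis
    by (metis UN_binaryset_eq sums_unique2)
qed

lemma ca_split:
  assumes "\<mu> \<in> ca M" "A \<in> sets M" "B \<in> sets M"
  shows "\<mu> A = \<mu> (A \<inter> B) + \<mu> (A - B)"
  using ca_Un[OF assms(1), of "A \<inter> B" "A - B"] assms(2,3)
  by (simp add: Int_Diff_Un Int_Diff_disjoint sets.Int sets.Diff)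

text \<open>Absolute continuity and supports see \<open>\<mu>\<close> only through the null events
  of its variation, and this criterion describes those events by \<open>\<mu>\<close> itself. A
  single subset \<open>B\<close> is tested by the partition of \<open>A\<close> into
  \<open>B\<close> and \<open>A - B\<close>.\<close>

lemma total_variation_eq_0_iff:
  assumes \<mu>: "\<mu> \<in> ca M" and A: "A \<in> sets M"
  shows "total_variation M \<mu> A = 0 \<longleftrightarrow> (\<forall>B\<in>sets M. B \<subseteq> A \<longrightarrow> \<mu> B = 0)"
proof
  assume tv: "total_variation M \<mu> A = 0"
  show "\<forall>B\<in>sets M. B \<subseteq> A \<longrightarrow> \<mu> B = 0"
  proof (intro ballI impI)
    fix B assume B: "B \<in> sets M" "B \<subseteq> A"
    show "\<mu> B = 0"
    proof (cases "B = {}")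
      case False
      \<comment> \<open>\<open>partition_on\<close> forbids empty blocks; \<open>A - B\<close> is
        empty when \<open>B = A\<close>.\<close>
      let ?D = "{B, A - B} - {{}}"
      have "ennreal \<bar>\<mu> B\<bar> \<le> (\<Sum>C\<in>?D. ennreal \<bar>\<mu> C\<bar>)"
        using False by (intro member_le_sum) auto
      also have "\<dots> \<le> total_variation M \<mu> A"
        unfolding total_variation_def using A B
        by (intro SUP_upper) (auto simp: partition_on_def disjoint_def)
      finally show ?thesis
        using tv by simp
    qed (use ca_empty[OF \<mu>] in simp)
  qed
next
  assume "\<forall>B\<in>sets M. B \<subseteq> A \<longrightarrow> \<mu> B = 0"
  then have "(\<Sum>B\<in>D. ennreal \<bar>\<mu> B\<bar>) = 0" if "D \<subseteq> sets M" "partition_on A D" for D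
    using that by (intro sum.neutral) (auto simp: partition_on_def)
  then have "total_variation M \<mu> A \<le> 0"
    unfolding total_variation_def by (intro SUP_least) auto
  then show "total_variation M \<mu> A = 0"
    by simp
qed

text \<open>Exhaustion: subsets that are nearly as negative as possible are removed from
  \<open>A\<close> one after another. Their values are summable and hence tend to 0, so nothing
  negative is left, and removing nonpositive mass cannot lower the value.\<close>

lemma ca_positive_subset:
  assumes \<mu>: "\<mu> \<in> ca M" and A: "A \<in> sets M"
  obtains B where "B \<in> sets M" "B \<subseteq> A" "\<mu> A \<le> \<mu> B" "\<forall>C\<in>sets M. C \<subseteq> B \<longrightarrow> 0 \<le> \<mu> C"
proof -
  \<comment> \<open>\<open>V\<close> is at least half as negative as every subset of
    \<open>U\<close>. The cap at \<open>- 1\<close> makes this meaningful while it is not known that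
    the values on subsets of \<open>U\<close> are bounded below.\<close>
  define good where "good U V \<longleftrightarrow> V \<in> sets M \<and> V \<subseteq> U \<and> \<mu> V \<le> 0 \<and>
    (\<forall>C\<in>sets M. C \<subseteq> U \<longrightarrow> \<mu> V \<le> max (\<mu> C / 2) (- 1))" for U V
  have ex: "\<exists>V. good U V" if U: "U \<in> sets M" for U
  proof (rule ccontr)
    assume no: "\<not> (\<exists>V. good U V)"
    have step: "\<exists>C\<in>sets M. C \<subseteq> U \<and> \<mu> C < 2 * \<mu> V \<and> - 1 < \<mu> V" if "V \<in> sets M" "V \<subseteq> U" "\<mu> V \<le> 0" for V
    proof -
      obtain C where "C \<in> sets M" "C \<subseteq> U" "\<not> \<mu> V \<le> max (\<mu> C / 2) (- 1)"
      proof -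
        have "\<not> good U V"
          using no by blast
        then show ?thesis
          using that \<open>V \<in> sets M\<close> \<open>V \<subseteq> U\<close> \<open>\<mu> V \<le> 0\<close> unfolding good_def by metis
      qed
      then show ?thesis
        by (intro bexI[of _ C]) (auto simp: max_def split: if_splits)
    qed
    \<comment> \<open>Applying \<open>step\<close> to the empty set already produces a strictly
      negative value.\<close>
    obtain C where C: "C \<in> sets M" "C \<subseteq> U" "\<mu> C < 0"
      using step[of "{}"] ca_empty[OF \<mu>] by auto
    \<comment> \<open>Each use of \<open>step\<close> at least doubles the negative value. The
      values therefore pass \<open>- 1\<close>, which \<open>step\<close> excludes.\<close>
    have "\<exists>V\<in>sets M. V \<subseteq> U \<and> \<mu> V \<le> 2 ^ n * \<mu> C" for n :: nat
    proof (induction n)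
      case (Suc n)
      then obtain V where V: "V \<in> sets M" "V \<subseteq> U" "\<mu> V \<le> 2 ^ n * \<mu> C"
        by auto
      then have "\<mu> V \<le> 0"
        using mult_nonneg_nonpos[of "2 ^ n" "\<mu> C"] C(3) by simp
      then obtain D where "D \<in> sets M" "D \<subseteq> U" "\<mu> D < 2 * \<mu> V"
        using step[OF V(1,2)] by auto
      with V(3) show ?case
        by (intro bexI[of _ D]) auto
    qed (use C in auto)
    moreover obtain n where "1 / - \<mu> C < 2 ^ n"
      using real_arch_pow[of 2 "1 / - \<mu> C"] by auto
    then have "2 ^ n * \<mu> C < - 1"
      using C(3) by (simp add: field_simps)
    ultimately obtain V where V: "V \<in> sets M" "V \<subseteq> U" "\<mu> V \<le> - 1"
      by (meson less_imp_le order_trans)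
    with step[of V] show False
      by auto
  qed
  define f where "f U = (SOME V. good U V)" for U
  have f: "good U (f U)" if "U \<in> sets M" for U
    using someI_ex[OF ex[OF that]] by (simp add: f_def)
  define U where "U = rec_nat A (\<lambda>_ U. U - f U)"
  have U_simps: "U 0 = A" "U (Suc n) = U n - f (U n)" for n
    by (simp_all add: U_def)
  have U_sets: "U n \<in> sets M" for n
    by (induction n) (use A f in \<open>auto simp: U_simps good_def\<close>)
  define V where "V n = f (U n)" for n
  have V: "good (U n) (V n)" for n
    using f[OF U_sets] by (simp add: V_def)
  have V_sets: "V n \<in> sets M" "V n \<subseteq> U n" for n
    using V[of n] by (simp_all add: good_def)
  have U_anti: "decseq U"
    by (rule decseq_SucI) (auto simp: U_simps)
  have disj: "V i \<inter> V j = {}" if "i < j" for i j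
  proof -
    have "V j \<subseteq> U (Suc i)"
      using V_sets(2)[of j] decseqD[OF U_anti, of "Suc i" j] that by auto
    then show ?thesis
      by (auto simp: U_simps V_def)
  qed
  then have disj: "disjoint_family V"
    unfolding disjoint_family_on_def by (metis Int_commute linorder_neqE_nat)
  define W where "W = (\<Union>n. V n)"
  have W: "W \<in> sets M"
    using V_sets by (auto simp: W_def)
  have sums: "(\<lambda>n. \<mu> (V n)) sums \<mu> W"
    unfolding W_def by (rule ca_sums[OF \<mu> _ disj]) (use V_sets in auto)
  have neg: "\<mu> (V n) \<le> 0" for n
    using V[of n] by (simp add: good_def)
  have W_A: "W \<subseteq> A"
    using V_sets(2) decseqD[OF U_anti, of 0] by (fastforce simp: W_def U_simps)
  have rest: "A - W \<subseteq> U n" for n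
    by (induction n) (auto simp: U_simps W_def V_def)
  show ?thesis
  proof (rule that[of "A - W"])
    show "A - W \<in> sets M" "A - W \<subseteq> A"
      using A W by auto
    have "\<mu> W \<le> 0"
      using sums neg sums_le[OF _ sums sums_zero] by auto
    then show "\<mu> A \<le> \<mu> (A - W)"
      using ca_split[OF \<mu> A W] W_A by (simp add: Int_absorb1)
    show "\<forall>C\<in>sets M. C \<subseteq> A - W \<longrightarrow> 0 \<le> \<mu> C"
    proof (intro ballI impI)
      fix C assume C: "C \<in> sets M" "C \<subseteq> A - W"
      \<comment> \<open>\<open>C\<close> lies in every \<open>U n\<close> and so competes at every
        stage. As the left side tends to 0, the bound can survive only if \<open>\<mu> C\<close> is
        nonnegative.\<close>
      have le: "\<mu> (V n) \<le> max (\<mu> C / 2) (- 1)" for n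
        using V[of n] C rest[of n] by (auto simp: good_def)
      have "(\<lambda>n. \<mu> (V n)) \<longlonglongrightarrow> 0"
        using sums sums_summable summable_LIMSEQ_zero by blast
      then have "0 \<le> max (\<mu> C / 2) (- 1)"
        by (rule LIMSEQ_le_const2) (use le in auto)
      then show "0 \<le> \<mu> C"
        by auto
    qed
  qed
qed

text \<open>\<open>H\<close> is a positive event of maximal value. An event of positive value
  disjoint from \<open>H\<close> would contain a positive event by
  \<open>ca_positive_subset\<close>, and joining that one to \<open>H\<close> would exceed the
  maximum.\<close>

lemma ca_Hahn_decomposition:
  assumes \<mu>: "\<mu> \<in> ca M"
  obtains H where "H \<in> sets M" "\<forall>A\<in>sets M. A \<subseteq> H \<longrightarrow> 0 \<le> \<mu> A"
    "\<forall>A\<in>sets M. A \<inter> H = {} \<longrightarrow> \<mu> A \<le> 0"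
proof -
  define Pos where "Pos = {H\<in>sets M. \<forall>A\<in>sets M. A \<subseteq> H \<longrightarrow> 0 \<le> \<mu> A}"
  have Pos_Un: "(\<Union>n. H n) \<in> Pos" if H: "\<And>n::nat. H n \<in> Pos" for H
  proof -
    have "0 \<le> \<mu> A" if A: "A \<in> sets M" "A \<subseteq> (\<Union>n. H n)" for A
    proof -
      have "(\<lambda>n. \<mu> (A \<inter> disjointed H n)) sums \<mu> (\<Union>n. A \<inter> disjointed H n)"
        using H A sets.range_disjointed_sets[of H M] disjoint_family_disjointed[of H]
        by (intro ca_sums[OF \<mu>])
          (auto simp: Pos_def image_subset_iff intro: disjoint_family_on_bisimulation)
      moreover have "(\<Union>n. A \<inter> disjointed H n) = A"
        using A(2) UN_disjointed_eq[of H] by auto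
      moreover have "0 \<le> \<mu> (A \<inter> disjointed H n)" for n
      proof -
        have "disjointed H n \<in> sets M"
          using sets.range_disjointed_sets[of H M] H by (auto simp: Pos_def)
        then have "A \<inter> disjointed H n \<in> sets M" "A \<inter> disjointed H n \<subseteq> H n"
          using A disjointed_subset[of H n] by auto
        then show ?thesis
          using H[of n] unfolding Pos_def by blast
      qed
      ultimately show ?thesis
        using sums_le[OF _ sums_zero, of "\<lambda>n. \<mu> (A \<inter> disjointed H n)"] by simp
    qed
    moreover have "(\<Union>n. H n) \<in> sets M"
      using H by (intro sets.countable_UN) (auto simp: Pos_def)
    ultimately show ?thesis
      unfolding Pos_def by blast
  qed
  have Pos_mono: "\<mu> A \<le> \<mu> B" if "A \<in> Pos" "B \<in> Pos" "A \<subseteq> B" for A B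
    using ca_split[OF \<mu>, of B A] that by (auto simp: Pos_def Int_absorb1)
  have "{} \<in> Pos"
    using ca_empty[OF \<mu>] by (auto simp: Pos_def)
  \<comment> \<open>The value of the union of a sequence of positive events dominates all their
    values, so real-valuedness of \<open>\<mu>\<close> excludes an unbounded sequence.\<close>
  have bdd: "bdd_above (\<mu> ` Pos)"
  proof (rule ccontr)
    assume "\<not> bdd_above (\<mu> ` Pos)"
    then have "\<forall>n::nat. \<exists>H\<in>Pos. real n < \<mu> H"
      unfolding bdd_above_def by (auto simp: not_le)
    then obtain H where H: "\<And>n. H n \<in> Pos" "\<And>n::nat. real n < \<mu> (H n)"
      by metis
    obtain n where "\<mu> (\<Union>n. H n) < real n"
      using reals_Archimedean2 by blast
    with H(2)[of n] Pos_mono[OF H(1)[of n] Pos_Un[of H, OF H(1)]] show False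
      by fastforce
  qed
  define s where "s = (SUP H\<in>Pos. \<mu> H)"
  have "\<exists>H\<in>Pos. s - 1 / real (Suc n) < \<mu> H" for n
    unfolding s_def using less_cSUP_iff[OF _ bdd, of "s - 1 / real (Suc n)"] \<open>{} \<in> Pos\<close>
    by (auto simp: s_def)
  then obtain H where H: "\<And>n. H n \<in> Pos" "\<And>n. s - 1 / real (Suc n) < \<mu> (H n)"
    by metis
  let ?H = "\<Union>n. H n"
  have HP: "?H \<in> Pos"
    by (rule Pos_Un[OF H(1)])
  have "s \<le> \<mu> ?H"
  proof (rule field_le_epsilon)
    fix e :: real assume "0 < e"
    then obtain n where "1 / real (Suc n) < e"
      using nat_approx_posE by blast
    moreover have "\<mu> (H n) \<le> \<mu> ?H" for n
      by (rule Pos_mono[OF H(1) HP]) auto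
    ultimately show "s \<le> \<mu> ?H + e"
      using H(2)[of n] by (smt (verit))
  qed
  show ?thesis
  proof (rule that[of ?H])
    show "\<forall>A\<in>sets M. A \<inter> ?H = {} \<longrightarrow> \<mu> A \<le> 0"
    proof (intro ballI impI)
      fix A assume A: "A \<in> sets M" "A \<inter> ?H = {}"
      obtain B where B: "B \<in> sets M" "B \<subseteq> A" "\<mu> A \<le> \<mu> B" "\<forall>C\<in>sets M. C \<subseteq> B \<longrightarrow> 0 \<le> \<mu> C"
        using ca_positive_subset[OF \<mu> A(1)] .
      have "B \<in> Pos"
        using B by (simp add: Pos_def)
      have BH: "B \<union> ?H \<in> Pos"
      proof -
        \<comment> \<open>\<open>case_nat\<close> prepends \<open>B\<close> to the sequence, which
          reduces the binary union to \<open>Pos_Un\<close>.\<close>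
        have "(\<Union>n. case_nat B H n) \<in> Pos"
          by (rule Pos_Un) (use \<open>B \<in> Pos\<close> H(1) in \<open>simp split: nat.split\<close>)
        moreover have "(\<Union>n. case_nat B H n) = B \<union> ?H"
          by (subst UNIV_nat_eq) (simp add: image_image)
        ultimately show ?thesis
          by simp
      qed
      have "\<mu> (B \<union> ?H) = \<mu> B + \<mu> ?H"
      proof (rule ca_Un[OF \<mu> B(1)])
        show "?H \<in> sets M"
          using HP by (simp add: Pos_def)
      qed (use A(2) B(2) in blast)
      moreover have "\<mu> (B \<union> ?H) \<le> s"
        unfolding s_def by (rule cSUP_upper[OF BH bdd])
      ultimately show "\<mu> A \<le> 0"
        using \<open>s \<le> \<mu> ?H\<close> B(3) by linarith
    qed
  qed (use HP in \<open>auto simp: Pos_def\<close>)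
qed


section \<open>Directed families and separation over a finite measure\<close>

text \<open>Fatou's lemma with a constant bound. It serves to pass from truncated functions to the
  functions themselves.\<close>

lemma nn_integral_le_LIMSEQ:
  assumes "\<And>n. u n \<in> borel_measurable M" "\<And>w. (\<lambda>n. u n w) \<longlonglongrightarrow> f w"
    and "\<And>n::nat. (\<integral>\<^sup>+ w. u n w \<partial>M) \<le> (c::ennreal)"
  shows "(\<integral>\<^sup>+ w. f w \<partial>M) \<le> c"
proof -
  have "f w = liminf (\<lambda>n. u n w)" for w
    using lim_imp_Liminf[OF sequentially_bot assms(2)] by simp
  then have "(\<integral>\<^sup>+ w. f w \<partial>M) = (\<integral>\<^sup>+ w. liminf (\<lambda>n. u n w) \<partial>M)"
    by simp
  also have "\<dots> \<le> liminf (\<lambda>n. \<integral>\<^sup>+ w. u n w \<partial>M)"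
    by (intro nn_integral_liminf assms(1))
  also have "\<dots> \<le> liminf (\<lambda>n. c)"
    using assms(3) by (intro Liminf_mono always_eventually) auto
  finally show ?thesis
    by (simp add: Liminf_const)
qed

lemma LIMSEQ_min_nat: "(\<lambda>n. min (u::real) (real n)) \<longlonglongrightarrow> u"
proof (rule tendsto_eventually)
  obtain N :: nat where "u \<le> real N"
    using real_arch_simple by blast
  then show "\<forall>\<^sub>F n in sequentially. min u (real n) = u"
    by (intro eventually_sequentiallyI[of N]) (auto simp: min_def)
qed

text \<open>The family may be uncountable, but a sequence in it that decreases a.e. attains the
  infimum \<open>s\<close> of the truncated integrals. Its limit \<open>z\<close> lies a.e. below
  every member, so \<open>inf\<close> forces \<open>z\<close> to vanish a.e. and \<open>s\<close> to
  be 0.\<close>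

lemma (in finite_measure) directed_inf_integral:
  fixes y :: "'i \<Rightarrow> 'a \<Rightarrow> real"
  assumes y [measurable]: "\<And>a. a \<in> I \<Longrightarrow> y a \<in> borel_measurable M" and "I \<noteq> {}"
    and nonneg: "\<And>a w. a \<in> I \<Longrightarrow> 0 \<le> y a w"
    and dir: "\<And>a b. a \<in> I \<Longrightarrow> b \<in> I \<Longrightarrow> \<exists>c\<in>I. (AE w in M. y c w \<le> y a w) \<and> (AE w in M. y c w \<le> y b w)"
    and inf: "\<And>z. z \<in> borel_measurable M \<Longrightarrow> (\<And>a. a \<in> I \<Longrightarrow> AE w in M. z w \<le> y a w) \<Longrightarrow>
      AE w in M. z w \<le> 0"
    and K: "0 \<le> K" and e: "0 < e"
  shows "\<exists>a\<in>I. (\<integral>w. min K (y a w) \<partial>M) < e"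
proof -
  define \<phi> where "\<phi> a = (\<integral>w. min K (y a w) \<partial>M)" for a
  have bounded_integrable: "integrable M f" if "f \<in> borel_measurable M" "\<And>w. 0 \<le> f w" "\<And>w. f w \<le> K"
    for f :: "'a \<Rightarrow> real"
    using that by (intro integrable_const_bound[of _ K]) auto
  have int [intro]: "integrable M (\<lambda>w. min K (y a w))" if "a \<in> I" for a
    using that nonneg K by (intro bounded_integrable) auto
  have mono: "\<phi> a \<le> \<phi> b" if "a \<in> I" "b \<in> I" "AE w in M. y a w \<le> y b w" for a b
    unfolding \<phi>_def using that by (intro integral_mono_AE int) (auto elim!: eventually_mono)
  have \<phi>_nonneg: "0 \<le> \<phi> a" if "a \<in> I" for a
    unfolding \<phi>_def using K nonneg[OF that] by (intro integral_nonneg_AE) auto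
  have bdd: "bdd_below (\<phi> ` I)"
    using \<phi>_nonneg by (intro bdd_belowI2)
  define s where "s = (INF a\<in>I. \<phi> a)"
  have s_le: "s \<le> \<phi> a" if "a \<in> I" for a
    unfolding s_def using bdd that by (rule cINF_lower)
  have near: "\<exists>a\<in>I. \<phi> a < s + 1 / real (Suc n)" for n
    using cINF_less_iff[OF \<open>I \<noteq> {}\<close> bdd, of "s + 1 / real (Suc n)"] by (simp add: s_def)
  \<comment> \<open>The next index is chosen below both the current one and a near-minimiser, so the
    sequence decreases a.e. and is minimising.\<close>
  have "\<exists>c. \<forall>n. c n \<in> I \<and> \<phi> (c n) < s + 1 / real (Suc n) \<and> (AE w in M. y (c (Suc n)) w \<le> y (c n) w)"
  proof (rule dependent_nat_choice[where P = "\<lambda>n a. a \<in> I \<and> \<phi> a < s + 1 / real (Suc n)" and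
      Q = "\<lambda>n a b. AE w in M. y b w \<le> y a w", simplified conj_assoc])
    show "\<exists>a. a \<in> I \<and> \<phi> a < s + 1 / real (Suc 0)"
      using near[of 0] by auto
    fix a n assume a: "a \<in> I \<and> \<phi> a < s + 1 / real (Suc n)"
    obtain b where b: "b \<in> I" "\<phi> b < s + 1 / real (Suc (Suc n))"
      using near by blast
    obtain c where c: "c \<in> I" "AE w in M. y c w \<le> y a w" "AE w in M. y c w \<le> y b w"
      using dir[of a b] a b by blast
    with mono[OF c(1) b(1) c(3)] b(2)
    show "\<exists>c. c \<in> I \<and> \<phi> c < s + 1 / real (Suc (Suc n)) \<and> (AE w in M. y c w \<le> y a w)"
      by auto
  qed
  then obtain c where c: "\<And>n. c n \<in> I" "\<And>n. \<phi> (c n) < s + 1 / real (Suc n)"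
    and c_dec: "\<And>n. AE w in M. y (c (Suc n)) w \<le> y (c n) w"
    by auto
  note [measurable] = y[OF c(1)]
  define u where "u n w = min K (y (c n) w)" for n w
  have u_meas [measurable]: "u n \<in> borel_measurable M" for n
    unfolding u_def by measurable
  have u_bounds: "0 \<le> u n w" "u n w \<le> K" for n w
    using nonneg[OF c(1)] K by (auto simp: u_def)
  have u_bdd: "bdd_below (range (\<lambda>n. u n w))" for w
    using u_bounds by (intro bdd_belowI2)
  define z where "z w = (INF n. u n w)" for w
  have z_meas [measurable]: "z \<in> borel_measurable M"
    unfolding z_def using u_bdd by (intro borel_measurable_cINF) auto
  have z_bounds: "0 \<le> z w" "z w \<le> K" for w
    using u_bounds u_bdd[of w] unfolding z_def
    by (auto intro!: cINF_greatest cINF_lower2[where x = 0])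
  have "AE w in M. \<forall>n. y (c (Suc n)) w \<le> y (c n) w"
    using c_dec by (simp add: AE_all_countable)
  then have u_lim: "AE w in M. (\<lambda>n. u n w) \<longlonglongrightarrow> z w"
  proof (rule eventually_mono)
    fix w assume "\<forall>n. y (c (Suc n)) w \<le> y (c n) w"
    then have "decseq (\<lambda>n. u n w)"
      unfolding u_def by (intro decseq_SucI min.mono) auto
    then show "(\<lambda>n. u n w) \<longlonglongrightarrow> z w"
      unfolding z_def using u_bdd by (intro LIMSEQ_decseq_INF)
  qed
  have lim_s: "(\<lambda>n. \<phi> (c n)) \<longlonglongrightarrow> s"
  proof (rule tendsto_sandwich)
    show "\<forall>\<^sub>F n in sequentially. s \<le> \<phi> (c n)"
      using s_le c(1) by simp
    show "\<forall>\<^sub>F n in sequentially. \<phi> (c n) \<le> s + 1 / real (Suc n)"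
      using c(2) by (intro always_eventually allI less_imp_le)
    show "(\<lambda>n. s + 1 / real (Suc n)) \<longlonglongrightarrow> s"
      using tendsto_add[OF tendsto_const LIMSEQ_inverse_real_of_nat, of s]
      by (simp add: inverse_eq_divide)
  qed simp
  moreover have "(\<lambda>n. \<phi> (c n)) \<longlonglongrightarrow> (\<integral>w. z w \<partial>M)"
    unfolding \<phi>_def u_def[symmetric]
    by (rule integral_dominated_convergence[where w = "\<lambda>_. K"])
      (use u_lim u_bounds in auto)
  ultimately have int_z: "(\<integral>w. z w \<partial>M) = s"
    by (rule LIMSEQ_unique[symmetric])
  have "AE w in M. z w \<le> y a w" if a: "a \<in> I" for a
  proof -
    note [measurable] = y[OF a]
    \<comment> \<open>A common lower bound of \<open>y (c n)\<close> and \<open>y a\<close> belongs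
      to the family, so its truncated integral is at least \<open>s\<close>. In the limit
      \<open>min z (y a)\<close> has integral at least \<open>s\<close>, the integral of
      \<open>z\<close>, whence \<open>z\<close> lies a.e. below \<open>y a\<close>.\<close>
    have le: "s \<le> (\<integral>w. min (u n w) (y a w) \<partial>M)" for n
    proof -
      obtain b where b: "b \<in> I" "AE w in M. y b w \<le> y (c n) w" "AE w in M. y b w \<le> y a w"
        using dir[OF c(1) a] by blast
      have "s \<le> \<phi> b"
        by (rule s_le[OF b(1)])
      also have "\<dots> \<le> (\<integral>w. min (u n w) (y a w) \<partial>M)"
        unfolding \<phi>_def
      proof (rule integral_mono_AE[OF int[OF b(1)]])
        show "integrable M (\<lambda>w. min (u n w) (y a w))"
          using u_bounds[of n] nonneg[OF a] by (intro bounded_integrable) (auto simp: min_le_iff_disj)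
        show "AE w in M. min K (y b w) \<le> min (u n w) (y a w)"
          using b(2,3) by eventually_elim (auto simp: u_def)
      qed
      finally show ?thesis .
    qed
    have "(\<lambda>n. \<integral>w. min (u n w) (y a w) \<partial>M) \<longlonglongrightarrow> (\<integral>w. min (z w) (y a w) \<partial>M)"
    proof (rule integral_dominated_convergence[where w = "\<lambda>_. K"])
      show "AE w in M. (\<lambda>n. min (u n w) (y a w)) \<longlonglongrightarrow> min (z w) (y a w)"
        using u_lim by eventually_elim (auto intro: tendsto_intros)
      show "AE w in M. norm (min (u n w) (y a w)) \<le> K" for n
        using u_bounds[of n] nonneg[OF a] by (auto simp: min_le_iff_disj abs_of_nonneg)
    qed auto
    then have "s \<le> (\<integral>w. min (z w) (y a w) \<partial>M)"
      by (rule LIMSEQ_le_const) (use le in auto)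
    then have le0: "(\<integral>w. z w - min (z w) (y a w) \<partial>M) \<le> 0"
      using int_z z_bounds nonneg[OF a]
      by (subst Bochner_Integration.integral_diff)
        (auto intro!: bounded_integrable simp: min_le_iff_disj)
    have int_d: "integrable M (\<lambda>w. z w - min (z w) (y a w))"
      using z_bounds nonneg[OF a]
      by (intro Bochner_Integration.integrable_diff bounded_integrable) (auto simp: min_le_iff_disj)
    have "(\<integral>w. z w - min (z w) (y a w) \<partial>M) = 0"
      using le0 by (intro antisym integral_nonneg_AE) auto
    then have "AE w in M. z w - min (z w) (y a w) = 0"
      by (subst (asm) integral_nonneg_eq_0_iff_AE[OF int_d]) auto
    then show ?thesis
      by eventually_elim auto
  qed
  then have "AE w in M. z w \<le> 0"
    by (intro inf) auto
  then have "AE w in M. z w = 0"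
    by eventually_elim (use z_bounds in \<open>auto intro: antisym\<close>)
  then have "(\<integral>w. z w \<partial>M) = 0"
    by (rule integral_eq_zero_AE)
  then have "s \<le> 0"
    using int_z by simp
  obtain n where "1 / real (Suc n) < e"
    using nat_approx_posE[OF e] by blast
  with c(2)[of n] \<open>s \<le> 0\<close> have "\<phi> (c n) < e"
    by linarith
  with c(1) show ?thesis
    unfolding \<phi>_def by blast
qed


section \<open>Least-squares projection and separation in the positive cone\<close>

text \<open>By the parallelogram law a minimising sequence is Cauchy in square mean, hence in mean.
  A subsequence then converges a.e., and \<open>closed\<close> puts its limit into
  \<open>D\<close>.\<close>

lemma (in finite_measure) bounded_minimizer:
  fixes D :: "('a \<Rightarrow> real) set"
  assumes meas: "D \<subseteq> borel_measurable M" and "D \<noteq> {}"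
    and bounds: "\<And>f w. f \<in> D \<Longrightarrow> 0 \<le> f w \<and> f w \<le> x w" and xK: "\<And>w. x w \<le> K"
    and x [measurable]: "x \<in> borel_measurable M"
    and midpoint: "\<And>f g. f \<in> D \<Longrightarrow> g \<in> D \<Longrightarrow> (\<lambda>w. (f w + g w) / 2) \<in> D"
    and closed: "\<And>f h. (\<And>n::nat. f n \<in> D) \<Longrightarrow> h \<in> borel_measurable M \<Longrightarrow> (\<And>w. 0 \<le> h w \<and> h w \<le> x w) \<Longrightarrow>
      AE w in M. (\<lambda>n. f n w) \<longlonglongrightarrow> h w \<Longrightarrow> h \<in> D"
  obtains h where "h \<in> D" "\<And>f. f \<in> D \<Longrightarrow> (\<integral>w. (x w - h w)\<^sup>2 \<partial>M) \<le> (\<integral>w. (x w - f w)\<^sup>2 \<partial>M)"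
proof -
  define \<phi> where "\<phi> f = (\<integral>w. (x w - f w)\<^sup>2 \<partial>M)" for f
  have bounded_integrable: "integrable M f" if "f \<in> borel_measurable M" "\<And>w. \<bar>f w\<bar> \<le> L"
    for f :: "'a \<Rightarrow> real" and L
    using that by (intro integrable_const_bound[of _ L]) auto
  have int: "integrable M (\<lambda>w. (x w - f w)\<^sup>2)" if "f \<in> D" for f
  proof (rule bounded_integrable[of _ "K\<^sup>2"])
    show "(\<lambda>w. (x w - f w)\<^sup>2) \<in> borel_measurable M"
      using meas that by auto
    have "\<bar>x w - f w\<bar> \<le> K" for w
      using bounds[OF that, of w] xK[of w] by linarith
    then show "\<bar>(x w - f w)\<^sup>2\<bar> \<le> K\<^sup>2" for w
      using power_mono[of "\<bar>x w - f w\<bar>" K 2] by simp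
  qed
  obtain f0 where "f0 \<in> D"
    using \<open>D \<noteq> {}\<close> by auto
  have x0: "0 \<le> x w" for w
    using bounds[OF \<open>f0 \<in> D\<close>, of w] by linarith
  have bdd: "bdd_below (\<phi> ` D)"
    by (intro bdd_belowI2[of _ 0]) (auto simp: \<phi>_def)
  define d where "d = (INF f\<in>D. \<phi> f)"
  have d_le: "d \<le> \<phi> f" if "f \<in> D" for f
    unfolding d_def using bdd that by (rule cINF_lower)
  have "\<exists>f\<in>D. \<phi> f < d + 1 / real (Suc n)" for n
    using cINF_less_iff[OF \<open>D \<noteq> {}\<close> bdd, of "d + 1 / real (Suc n)"] by (simp add: d_def)
  then obtain f where f: "\<And>n. f n \<in> D" "\<And>n. \<phi> (f n) < d + 1 / real (Suc n)"
    by metis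
  have f_meas [measurable]: "f n \<in> borel_measurable M" for n
    using f(1) meas by auto
  have fK: "0 \<le> f n w" "f n w \<le> x w" "f n w \<le> K" for n w
    using bounds[OF f(1), of n w] xK[of w] by auto
  have f_int: "integrable M (f n)" for n
    using fK by (intro bounded_integrable[of _ K]) (auto simp: abs_of_nonneg)
  have sq_int: "integrable M (\<lambda>w. (f i w - f j w)\<^sup>2)" for i j
  proof (rule bounded_integrable[of _ "K\<^sup>2"])
    have "\<bar>f i w - f j w\<bar> \<le> \<bar>K\<bar>" for w
      using fK[of i w] fK[of j w] by linarith
    then show "\<bar>(f i w - f j w)\<^sup>2\<bar> \<le> K\<^sup>2" for w
      by (simp add: abs_le_square_iff)
  qed simp
  \<comment> \<open>Parallelogram law around \<open>x\<close>. The midpoint lies in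
    \<open>D\<close>, so its distance term is at least \<open>d\<close>, which cancels the two
    leading terms.\<close>
  have par: "(\<integral>w. (f i w - f j w)\<^sup>2 \<partial>M) \<le> 2 * (1 / real (Suc i)) + 2 * (1 / real (Suc j))" for i j
  proof -
    let ?m = "\<lambda>w. (f i w + f j w) / 2"
    have m: "?m \<in> D"
      by (rule midpoint[OF f(1) f(1)])
    have "(\<integral>w. (f i w - f j w)\<^sup>2 \<partial>M) =
        (\<integral>w. 2 * (x w - f i w)\<^sup>2 + 2 * (x w - f j w)\<^sup>2 - 4 * (x w - ?m w)\<^sup>2 \<partial>M)"
      by (intro Bochner_Integration.integral_cong refl) (simp add: power2_eq_square field_simps)
    also have "\<dots> = 2 * \<phi> (f i) + 2 * \<phi> (f j) - 4 * \<phi> ?m"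
      using int[OF f(1)[of i]] int[OF f(1)[of j]] int[OF m] unfolding \<phi>_def by simp
    also have "\<dots> \<le> 2 * (1 / real (Suc i)) + 2 * (1 / real (Suc j))"
      using f(2)[of i] f(2)[of j] d_le[OF m] by linarith
    finally show ?thesis .
  qed
  have cauchy: "\<exists>N. \<forall>i\<ge>N. \<forall>j\<ge>N. (\<integral>w. norm (f i w - f j w) \<partial>M) < e" if e: "0 < e" for e
  proof -
    \<comment> \<open>The summand 1 keeps \<open>c\<close> positive for the zero measure. With
      \<open>\<epsilon> = e / c\<close> the constant \<open>\<epsilon>\<close> integrates to less
      than \<open>e / 2\<close>.\<close>
    define c where "c = 2 * (measure M (space M) + 1)"
    have c: "0 < c" "measure M (space M) / c < 1 / 2"
      by (auto simp: c_def field_simps add_pos_nonneg intro: add_nonneg_pos)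
    define \<epsilon> where "\<epsilon> = e / c"
    have \<epsilon>: "0 < \<epsilon>"
      using e c by (simp add: \<epsilon>_def)
    obtain N where N: "1 / real (Suc N) < \<epsilon> * e / 8"
      using nat_approx_posE[of "\<epsilon> * e / 8"] e \<epsilon> by auto
    have "(\<integral>w. norm (f i w - f j w) \<partial>M) < e" if "N \<le> i" "N \<le> j" for i j
    proof -
      have "1 / real (Suc i) \<le> 1 / real (Suc N)" "1 / real (Suc j) \<le> 1 / real (Suc N)"
        using that by (auto intro!: divide_left_mono)
      then have sq: "(\<integral>w. (f i w - f j w)\<^sup>2 \<partial>M) < \<epsilon> * (e / 2)"
        using par[of i j] N by linarith
      have "(\<integral>w. norm (f i w - f j w) \<partial>M) \<le> (\<integral>w. \<epsilon> + (f i w - f j w)\<^sup>2 / \<epsilon> \<partial>M)"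
      proof (rule integral_mono)
        show "integrable M (\<lambda>w. norm (f i w - f j w))"
          using f_int by auto
        show "integrable M (\<lambda>w. \<epsilon> + (f i w - f j w)\<^sup>2 / \<epsilon>)"
          using sq_int by auto
        fix w
        let ?u = "\<bar>f i w - f j w\<bar>"
        \<comment> \<open>Dividing the expanded inequality by \<open>\<epsilon>\<close> bounds
          \<open>?u\<close> by \<open>\<epsilon> + ?u\<^sup>2 / \<epsilon>\<close>, which turns the
          estimate in square mean into one in mean.\<close>
        have "0 \<le> (?u - \<epsilon>)\<^sup>2 + ?u * \<epsilon>"
          using \<epsilon> by auto
        then have "?u * \<epsilon> \<le> \<epsilon> * \<epsilon> + ?u\<^sup>2"
          by (simp add: power2_eq_square algebra_simps)
        then show "norm (f i w - f j w) \<le> \<epsilon> + (f i w - f j w)\<^sup>2 / \<epsilon>"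
          using \<epsilon> by (simp add: field_simps)
      qed
      also have "\<dots> = \<epsilon> * measure M (space M) + (\<integral>w. (f i w - f j w)\<^sup>2 \<partial>M) / \<epsilon>"
        using sq_int[of i j] by simp
      also have "\<epsilon> * measure M (space M) < e / 2"
        using mult_strict_left_mono[OF c(2) e] by (simp add: \<epsilon>_def)
      also have "(\<integral>w. (f i w - f j w)\<^sup>2 \<partial>M) / \<epsilon> < e / 2"
        using sq \<epsilon> by (simp add: pos_divide_less_eq mult.commute)
      finally show ?thesis
        by simp
    qed
    then show ?thesis
      by blast
  qed
  obtain r where r: "strict_mono r" "AE w in M. Cauchy (\<lambda>n. f (r n) w)"
    using cauchy_L1_AE_cauchy_subseq[OF f_int cauchy] by blast
  \<comment> \<open>Clamping makes the bounds hold everywhere, also where the subsequence diverges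
    and \<open>lim\<close> is unspecified. On the convergence set it changes nothing.\<close>
  define h where "h w = min (x w) (max 0 (lim (\<lambda>n. f (r n) w)))" for w
  have h_meas [measurable]: "h \<in> borel_measurable M"
    unfolding h_def by measurable
  have h_bounds: "0 \<le> h w \<and> h w \<le> x w" for w
    using x0[of w] by (auto simp: h_def)
  have h_lim: "AE w in M. (\<lambda>n. f (r n) w) \<longlonglongrightarrow> h w"
    using r(2)
  proof eventually_elim
    fix w assume "Cauchy (\<lambda>n. f (r n) w)"
    then have lim: "(\<lambda>n. f (r n) w) \<longlonglongrightarrow> lim (\<lambda>n. f (r n) w)"
      by (simp add: Cauchy_convergent_iff convergent_LIMSEQ_iff)
    have "0 \<le> lim (\<lambda>n. f (r n) w)" "lim (\<lambda>n. f (r n) w) \<le> x w"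
      using LIMSEQ_le_const[OF lim] LIMSEQ_le_const2[OF lim] fK by auto
    with lim show "(\<lambda>n. f (r n) w) \<longlonglongrightarrow> h w"
      by (simp add: h_def)
  qed
  have hD: "h \<in> D"
    by (rule closed[OF _ h_meas h_bounds h_lim]) (rule f(1))
  have "(\<lambda>n. \<phi> (f (r n))) \<longlonglongrightarrow> \<phi> h"
    unfolding \<phi>_def
  proof (rule integral_dominated_convergence[where w = "\<lambda>_. K\<^sup>2"])
    show "AE w in M. (\<lambda>n. (x w - f (r n) w)\<^sup>2) \<longlonglongrightarrow> (x w - h w)\<^sup>2"
      using h_lim by eventually_elim (intro tendsto_intros)
    have "\<bar>x w - f (r n) w\<bar> \<le> K" for n w
      using fK[of "r n" w] xK[of w] by linarith
    then show "AE w in M. norm ((x w - f (r n) w)\<^sup>2) \<le> K\<^sup>2" for n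
      using power_mono[of "\<bar>x w - f (r n) w\<bar>" K 2 for w] by simp
  qed auto
  moreover have "\<phi> (f (r n)) \<le> d + 1 / real (Suc n)" for n
  proof -
    have "1 / real (Suc (r n)) \<le> 1 / real (Suc n)"
      using strict_mono_imp_increasing[OF r(1)] by (intro divide_left_mono) auto
    with f(2)[of "r n"] show ?thesis
      by linarith
  qed
  moreover have "(\<lambda>n. d + 1 / real (Suc n)) \<longlonglongrightarrow> d"
    using tendsto_add[OF tendsto_const LIMSEQ_inverse_real_of_nat, of d]
    by (simp add: inverse_eq_divide)
  ultimately have "\<phi> h \<le> d"
    by (intro LIMSEQ_le) auto
  with hD d_le show ?thesis
    using that[of h] unfolding \<phi>_def by force
qed


text \<open>The nontrivial half of the Brannath-Schachermayer bipolar theorem. A truncation of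
  \<open>x\<close> is projected onto the part of \<open>D\<close> below it. The residual
  \<open>g\<close> is bounded and nonnegative; its integral against bounded members of
  \<open>D\<close> is at most \<open>b\<close>, and against the truncation it is
  \<open>b + a\<close> with \<open>a > 0\<close>.\<close>

lemma (in finite_measure) bipolar_separation:
  fixes D :: "('a \<Rightarrow> real) set"
  assumes meas: "D \<subseteq> borel_measurable M" and "D \<noteq> {}"
    and nonneg: "\<And>f w. f \<in> D \<Longrightarrow> 0 \<le> f w"
    and solid: "\<And>f g. f \<in> D \<Longrightarrow> g \<in> borel_measurable M \<Longrightarrow> (\<And>w. 0 \<le> g w \<and> g w \<le> f w) \<Longrightarrow> g \<in> D"
    and convex: "\<And>f g t. f \<in> D \<Longrightarrow> g \<in> D \<Longrightarrow> 0 \<le> t \<Longrightarrow> t \<le> 1 \<Longrightarrow> (\<lambda>w. t * f w + (1 - t) * g w) \<in> D"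
    and closed: "\<And>f h. (\<And>n::nat. f n \<in> D) \<Longrightarrow> h \<in> borel_measurable M \<Longrightarrow> (\<And>w. 0 \<le> h w) \<Longrightarrow>
      AE w in M. (\<lambda>n. f n w) \<longlonglongrightarrow> h w \<Longrightarrow> h \<in> D"
    and x [measurable]: "x \<in> borel_measurable M" and x0: "\<And>w. 0 \<le> x w" and "x \<notin> D"
  obtains g B where "g \<in> borel_measurable M" "\<And>w. 0 \<le> g w" "\<And>w. g w \<le> B"
    "\<And>f. f \<in> D \<Longrightarrow> (\<integral>\<^sup>+ w. ennreal (g w * f w) \<partial>M) \<le> 1"
    "1 < (\<integral>\<^sup>+ w. ennreal (g w * x w) \<partial>M)"
proof -
  have bounded_integrable: "integrable M f" if "f \<in> borel_measurable M" "\<And>w. \<bar>f w\<bar> \<le> L"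
    for f :: "'a \<Rightarrow> real" and L
    using that by (intro integrable_const_bound[of _ L]) auto
  \<comment> \<open>The truncations converge to \<open>x\<close>, so by closedness not all of them
    can lie in \<open>D\<close>.\<close>
  have "\<exists>K::nat. (\<lambda>w. min (x w) (real K)) \<notin> D"
  proof (rule ccontr)
    assume "\<not> ?thesis"
    then have "(\<lambda>w. min (x w) (real n)) \<in> D" for n
      by blast
    then have "x \<in> D"
      by (rule closed[of "\<lambda>n w. min (x w) (real n)", OF _ x x0]) (intro AE_I2 LIMSEQ_min_nat)
    with \<open>x \<notin> D\<close> show False ..
  qed
  then obtain K :: nat where K: "(\<lambda>w. min (x w) (real K)) \<notin> D"
    by blast
  define x' where "x' w = min (x w) (real K)" for w
  have x'_meas [measurable]: "x' \<in> borel_measurable M"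
    unfolding x'_def by measurable
  have x': "0 \<le> x' w" "x' w \<le> real K" "x' w \<le> x w" for w
    using x0[of w] by (auto simp: x'_def)
  have x'D: "x' \<notin> D"
    using K by (simp add: x'_def[abs_def])
  \<comment> \<open>Keeping the competitors below \<open>x'\<close> makes the residual
    \<open>x' - h\<close> nonnegative, as a density must be.\<close>
  define D' where "D' = {f\<in>D. \<forall>w. f w \<le> x' w}"
  have zero: "(\<lambda>w. 0) \<in> D"
    using \<open>D \<noteq> {}\<close> nonneg solid[of _ "\<lambda>w. 0"] by auto
  obtain h where hD': "h \<in> D'"
    and h_min: "\<And>f. f \<in> D' \<Longrightarrow> (\<integral>w. (x' w - h w)\<^sup>2 \<partial>M) \<le> (\<integral>w. (x' w - f w)\<^sup>2 \<partial>M)"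
  proof (rule bounded_minimizer[of D' x' "real K"])
    show "D' \<subseteq> borel_measurable M"
      using meas by (auto simp: D'_def)
    show "D' \<noteq> {}"
      using zero x' by (auto simp: D'_def)
    show "(\<lambda>w. (f w + g w) / 2) \<in> D'" if "f \<in> D'" "g \<in> D'" for f g
    proof -
      have "f w + g w \<le> 2 * x' w" for w
      proof -
        have "f w \<le> x' w" "g w \<le> x' w"
          using that by (auto simp: D'_def)
        then show ?thesis
          by linarith
      qed
      moreover have "(\<lambda>w. (f w + g w) / 2) \<in> D"
        using convex[of f g "1 / 2"] that by (simp add: D'_def add_divide_distrib)
      ultimately show ?thesis
        by (simp add: D'_def field_simps)
    qed
    show "h \<in> D'" if "\<And>n::nat. f n \<in> D'" "h \<in> borel_measurable M" "\<And>w. 0 \<le> h w \<and> h w \<le> x' w"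
      "AE w in M. (\<lambda>n. f n w) \<longlonglongrightarrow> h w" for f h
      using closed[of f h] that by (auto simp: D'_def)
  qed (use nonneg x' in \<open>auto simp: D'_def\<close>)
  have hD: "h \<in> D" and h: "\<And>w. 0 \<le> h w" "\<And>w. h w \<le> x' w"
    using hD' nonneg by (auto simp: D'_def)
  have h_meas [measurable]: "h \<in> borel_measurable M"
    using hD meas by auto
  have hK: "\<bar>h w\<bar> \<le> real K" for w
    using h[of w] x'[of w] by linarith
  define g where "g w = x' w - h w" for w
  have g_meas [measurable]: "g \<in> borel_measurable M"
    unfolding g_def by measurable
  have g: "0 \<le> g w" "g w \<le> real K" for w
    using h[of w] x'[of w] by (auto simp: g_def)
  have g_int: "integrable M (\<lambda>w. g w * f w)" if "f \<in> borel_measurable M" "\<And>w. \<bar>f w\<bar> \<le> L" for f L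
    using that g by (intro bounded_integrable[of _ "real K * L"]) (auto simp: abs_mult intro!: mult_mono)
  define b where "b = (\<integral>w. g w * h w \<partial>M)"
  have b0: "0 \<le> b"
    unfolding b_def using g h by (intro integral_nonneg_AE) auto
  text \<open>First-order optimality of \<open>h\<close> along the segment from \<open>h\<close> to \<open>f\<close>.\<close>
  have var: "(\<integral>w. g w * f w \<partial>M) \<le> b" if fD: "f \<in> D" and fL: "\<And>w. f w \<le> L" for f L
  proof -
    have [measurable]: "f \<in> borel_measurable M"
      using fD meas by auto
    have f0: "0 \<le> f w" for w
      by (rule nonneg[OF fD])
    have fh: "\<bar>f w - h w\<bar> \<le> L + real K" for w
      using f0[of w] fL[of w] h[of w] x'[of w] by linarith
    define c where "c = (\<integral>w. (f w - h w)\<^sup>2 \<partial>M)"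
    have i1: "integrable M (\<lambda>w. g w * (f w - h w))"
      by (rule g_int[OF _ fh]) simp
    have i2: "integrable M (\<lambda>w. (f w - h w)\<^sup>2)"
    proof (rule bounded_integrable[of _ "(L + real K)\<^sup>2"])
      show "\<bar>(f w - h w)\<^sup>2\<bar> \<le> (L + real K)\<^sup>2" for w
        using power_mono[OF fh[of w] abs_ge_zero, of 2] by simp
    qed simp
    have i3: "integrable M (\<lambda>w. (g w)\<^sup>2)"
      using g_int[of g "real K"] g by (simp add: power2_eq_square)
    define q where "q = (\<integral>w. g w * (f w - h w) \<partial>M)"
    have "2 * q \<le> t * c" if t: "0 < t" "t \<le> 1" for t
    proof -
      define k where "k w = t * f w + (1 - t) * h w" for w
      have kD: "k \<in> D"
        unfolding k_def using convex[OF fD hD, of t] t by simp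
      have k0: "0 \<le> k w" for w
        by (rule nonneg[OF kD])
      have [measurable]: "k \<in> borel_measurable M"
        using kD meas by auto
      \<comment> \<open>A point of the segment may exceed \<open>x'\<close>. Its minimum with
        \<open>x'\<close> is an admissible competitor by solidity, and its squared distance to
        \<open>x'\<close> is no larger.\<close>
      have mD: "(\<lambda>w. min (k w) (x' w)) \<in> D'"
        using solid[OF kD, of "\<lambda>w. min (k w) (x' w)"] k0 x' by (auto simp: D'_def)
      have i4: "integrable M (\<lambda>w. (g w)\<^sup>2 - 2 * t * (g w * (f w - h w)) + t\<^sup>2 * (f w - h w)\<^sup>2)"
        using i1 i2 i3 by (intro Bochner_Integration.integrable_add Bochner_Integration.integrable_diff
          integrable_mult_right)
      have k_eq: "(x' w - k w)\<^sup>2 = (g w)\<^sup>2 - 2 * t * (g w * (f w - h w)) + t\<^sup>2 * (f w - h w)\<^sup>2" for w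
        by (simp add: k_def g_def power2_eq_square algebra_simps)
      have "(\<integral>w. (g w)\<^sup>2 \<partial>M) \<le> (\<integral>w. (x' w - min (k w) (x' w))\<^sup>2 \<partial>M)"
        unfolding g_def by (rule h_min[OF mD])
      also have "\<dots> \<le> (\<integral>w. (x' w - k w)\<^sup>2 \<partial>M)"
      proof (rule integral_mono)
        show "integrable M (\<lambda>w. (x' w - k w)\<^sup>2)"
          using i4 by (simp add: k_eq)
        show "integrable M (\<lambda>w. (x' w - min (k w) (x' w))\<^sup>2)"
        proof (rule bounded_integrable[of _ "(real K)\<^sup>2"])
          have "\<bar>x' w - min (k w) (x' w)\<bar> \<le> real K" for w
            using x'[of w] k0[of w] by (auto simp: min_def)
          then show "\<bar>(x' w - min (k w) (x' w))\<^sup>2\<bar> \<le> (real K)\<^sup>2" for w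
            using power_mono[of "\<bar>x' w - min (k w) (x' w)\<bar>" "real K" 2] by simp
        qed simp
        show "(x' w - min (k w) (x' w))\<^sup>2 \<le> (x' w - k w)\<^sup>2" for w
          by (simp add: min_def)
      qed
      also have "\<dots> = (\<integral>w. (g w)\<^sup>2 \<partial>M) - 2 * t * q + t\<^sup>2 * c"
        using i1 i2 i3 by (simp add: k_eq q_def c_def)
      finally have "t * (2 * q) \<le> t * (t * c)"
        by (simp add: power2_eq_square)
      with t show ?thesis
        by (simp add: mult_le_cancel_left_pos)
    qed
    then have le: "2 * q \<le> c / real (Suc n)" for n
      by (drule_tac x = "1 / real (Suc n)" in meta_spec) simp
    have "(\<lambda>n. c / real (Suc n)) \<longlonglongrightarrow> 0"
      using tendsto_mult_right_zero[OF LIMSEQ_inverse_real_of_nat, of c]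
      by (simp add: divide_inverse)
    then have "2 * q \<le> 0"
      by (rule LIMSEQ_le_const) (use le in auto)
    moreover have "q = (\<integral>w. g w * f w \<partial>M) - b"
    proof -
      have "integrable M (\<lambda>w. g w * f w)"
        by (rule g_int[of _ L]) (use f0 fL in auto)
      moreover have "integrable M (\<lambda>w. g w * h w)"
        by (rule g_int[OF h_meas hK])
      ultimately show ?thesis
        unfolding q_def b_def by (simp add: right_diff_distrib)
    qed
    ultimately show ?thesis
      by simp
  qed
  define a where "a = (\<integral>w. g w * g w \<partial>M)"
  have gg_int: "integrable M (\<lambda>w. g w * g w)"
    by (rule g_int[of _ "real K"]) (use g in auto)
  \<comment> \<open>If \<open>g\<close> vanished a.e., the constant sequence \<open>h\<close> would
    converge a.e. to \<open>x'\<close>, and closedness would put \<open>x'\<close> into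
    \<open>D\<close>.\<close>
  have "a \<noteq> 0"
  proof
    assume "a = 0"
    then have "AE w in M. g w * g w = 0"
      unfolding a_def using g integral_nonneg_eq_0_iff_AE[OF gg_int] by auto
    then have "AE w in M. (\<lambda>n. h w) \<longlonglongrightarrow> x' w"
      by eventually_elim (simp add: g_def)
    then have "x' \<in> D"
      by (rule closed[OF hD x'_meas x'(1)])
    with x'D show False ..
  qed
  moreover have "0 \<le> a"
    unfolding a_def using g by (intro integral_nonneg_AE) auto
  ultimately have a0: "0 < a"
    by simp
  have gx': "(\<integral>w. g w * x' w \<partial>M) = b + a"
  proof -
    have "integrable M (\<lambda>w. g w * h w)"
      by (rule g_int[OF h_meas hK])
    then have "b + a = (\<integral>w. g w * h w + g w * g w \<partial>M)"
      unfolding a_def b_def using gg_int by simp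
    also have "\<dots> = (\<integral>w. g w * x' w \<partial>M)"
      by (intro Bochner_Integration.integral_cong refl) (simp add: g_def algebra_simps)
    finally show ?thesis ..
  qed
  \<comment> \<open>A normaliser strictly between \<open>b\<close> and \<open>b + a\<close>; it is
    positive even if \<open>b\<close> is 0.\<close>
  define c where "c = b + a / 2"
  have c: "0 < c" "b \<le> c" "c < b + a"
    using a0 b0 by (auto simp: c_def)
  show ?thesis
  proof (rule that[of "\<lambda>w. g w / c" "real K / c"])
    show "(\<lambda>w. g w / c) \<in> borel_measurable M"
      by measurable
    show "0 \<le> g w / c" "g w / c \<le> real K / c" for w
      using g c by (auto simp: divide_right_mono)
  next
    fix f assume fD: "f \<in> D"
    have [measurable]: "f \<in> borel_measurable M"
      using fD meas by auto
    have f0: "0 \<le> f w" for w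
      by (rule nonneg[OF fD])
    \<comment> \<open>\<open>var\<close> speaks of bounded members of \<open>D\<close> only. The
      truncations of \<open>f\<close> lie in \<open>D\<close> by solidity, and Fatou's lemma passes
      the bound on to \<open>f\<close>.\<close>
    show "(\<integral>\<^sup>+ w. ennreal (g w / c * f w) \<partial>M) \<le> 1"
    proof (rule nn_integral_le_LIMSEQ)
      show "(\<lambda>n. ennreal (g w / c * min (f w) (real n))) \<longlonglongrightarrow> ennreal (g w / c * f w)" for w
        by (intro tendsto_intros LIMSEQ_min_nat)
      show "(\<lambda>w. ennreal (g w / c * min (f w) (real n))) \<in> borel_measurable M" for n
        by measurable
      fix n :: nat
      let ?f = "\<lambda>w. min (f w) (real n)"
      have fn: "?f \<in> D"
        using f0 by (intro solid[OF fD]) auto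
      have i: "integrable M (\<lambda>w. g w * ?f w)"
        using f0 by (intro g_int[of _ "real n"]) auto
      have "(\<integral>\<^sup>+ w. ennreal (g w / c * ?f w) \<partial>M) = ennreal (\<integral>w. g w / c * ?f w \<partial>M)"
        using i g c f0 by (intro nn_integral_eq_integral) auto
      also have "(\<integral>w. g w / c * ?f w \<partial>M) = (\<integral>w. g w * ?f w \<partial>M) / c"
        by simp
      also have "\<dots> \<le> 1"
        using var[OF fn, of "real n"] c by simp
      finally show "(\<integral>\<^sup>+ w. ennreal (g w / c * ?f w) \<partial>M) \<le> 1"
        by (simp add: ennreal_leI)
    qed
  next
    have i: "integrable M (\<lambda>w. g w * x' w)"
      using x' by (intro g_int[of _ "real K"]) auto
    have "1 < (\<integral>w. g w * x' w \<partial>M) / c"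
      using c gx' by simp
    then have "1 < ennreal ((\<integral>w. g w * x' w \<partial>M) / c)"
      by (metis ennreal_1 ennreal_lessI less_trans zero_less_one)
    also have "\<dots> = ennreal (\<integral>w. g w / c * x' w \<partial>M)"
      by simp
    also have "\<dots> = (\<integral>\<^sup>+ w. ennreal (g w / c * x' w) \<partial>M)"
      using i g c x' by (intro nn_integral_eq_integral[symmetric]) auto
    also have "\<dots> \<le> (\<integral>\<^sup>+ w. ennreal (g w / c * x w) \<partial>M)"
      using g c x' by (intro nn_integral_mono ennreal_leI mult_left_mono) auto
    finally show "1 < (\<integral>\<^sup>+ w. ennreal (g w / c * x w) \<partial>M)" .
  qed
qed


section \<open>Supported measures and the lattice \<open>L0\<close>\<close>

locale capacity_space =
  fixes M :: "'a measure" and P :: "'a measure set"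
  assumes P: "P \<subseteq> prob_measures M" and P_nonempty: "P \<noteq> {}"
begin

abbreviation pol :: "'a set \<Rightarrow> bool" where
  "pol \<equiv> polar_event M P"

abbreviation qs :: "('a \<Rightarrow> bool) \<Rightarrow> bool" where
  "qs \<equiv> quasi_surely M P"

abbreviation cls :: "('a \<Rightarrow> real) \<Rightarrow> ('a \<Rightarrow> real) set" where
  "cls \<equiv> L0_class M P"

lemma pol_iff: "pol N \<longleftrightarrow> N \<in> sets M \<and> (\<forall>Q\<in>P. emeasure Q N = 0)"
proof -
  have "capacity P N = 0 \<longleftrightarrow> (\<forall>Q\<in>P. emeasure Q N = 0)"
    unfolding capacity_def using P_nonempty SUP_eq_iff[of P 0 "\<lambda>Q. emeasure Q N"]
    by (auto simp flip: bot_ennreal)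
  then show ?thesis
    by (simp add: polar_event_def)
qed

lemma pol_subset: "pol N \<Longrightarrow> A \<in> sets M \<Longrightarrow> A \<subseteq> N \<Longrightarrow> pol A"
  using P unfolding pol_iff prob_measures_def
  by (metis (mono_tags, lifting) emeasure_mono le_zero_eq mem_Collect_eq subsetD)

lemma pol_UN:
  assumes "\<And>n::nat. pol (N n)"
  shows "pol (\<Union>n. N n)"
proof -
  have "emeasure Q (\<Union>n. N n) = 0" if "Q \<in> P" for Q
    using assms that P by (intro emeasure_UN_eq_0) (auto simp: pol_iff prob_measures_def)
  then show ?thesis
    using assms by (auto simp: pol_iff)
qed

lemma qs_mp: "qs \<phi> \<Longrightarrow> (\<And>w. \<phi> w \<Longrightarrow> \<theta> w) \<Longrightarrow> qs \<theta>"
  unfolding quasi_surely_def by blast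

lemmas qs_mp2 = quasi_surely_mp2[OF P]

lemma qs_all:
  assumes "\<And>n::nat. qs (\<phi> n)"
  shows "qs (\<lambda>w. \<forall>n. \<phi> n w)"
proof -
  obtain N where N: "\<And>n. pol (N n)" "\<And>n. \<forall>w\<in>space M - N n. \<phi> n w"
    using assms unfolding quasi_surely_def by metis
  then show ?thesis
    unfolding quasi_surely_def by (intro exI[of _ "\<Union>n. N n"]) (auto intro!: pol_UN)
qed

lemma qs_pol: "qs \<phi> \<Longrightarrow> A \<in> sets M \<Longrightarrow> (\<And>w. w \<in> A \<Longrightarrow> \<not> \<phi> w) \<Longrightarrow> pol A"
  using sets.sets_into_space[of A M] pol_subset unfolding quasi_surely_def by blast

lemma pol_qs: "pol A \<Longrightarrow> (\<And>w. w \<in> space M \<Longrightarrow> w \<notin> A \<Longrightarrow> \<phi> w) \<Longrightarrow> qs \<phi>"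
  unfolding quasi_surely_def by blast

section \<open>Finite measures that vanish on polar events, and their supports\<close>

text \<open>The counterpart of \<open>ca_c_pos\<close> among library measures, which makes a.e.
  statements, densities and integrals available; \<open>ca_c_pos_eq\<close> gives the
  correspondence.\<close>

definition finite_ac :: "'a measure \<Rightarrow> bool" where
  "finite_ac m \<longleftrightarrow> finite_measure m \<and> sets m = sets M \<and> (\<forall>N. pol N \<longrightarrow> emeasure m N = 0)"

text \<open>\<open>supported\<close> with its witness made explicit, and with subsets of
  \<open>S\<close> in place of traces on \<open>S\<close>.\<close>

definition support_of :: "'a measure \<Rightarrow> 'a set \<Rightarrow> bool" where
  "support_of m S \<longleftrightarrow> S \<in> sets M \<and> emeasure m (space M - S) = 0 \<and>
    (\<forall>N\<in>sets M. N \<subseteq> S \<longrightarrow> emeasure m N = 0 \<longrightarrow> pol N)"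

lemma finite_acD:
  assumes "finite_ac m"
  shows "finite_measure m" "sets m = sets M" "space m = space M" "pol N \<Longrightarrow> emeasure m N = 0"
  using assms sets_eq_imp_space_eq[of m M] by (auto simp: finite_ac_def)

lemma measurable_finite_ac: "finite_ac m \<Longrightarrow> borel_measurable m = borel_measurable M"
  by (intro measurable_cong_sets finite_acD) auto

lemma qs_AE:
  assumes m: "finite_ac m" and \<phi>: "qs \<phi>"
  shows "AE w in m. \<phi> w"
proof -
  obtain N where N: "pol N" "\<forall>w\<in>space M - N. \<phi> w"
    using \<phi> by (auto simp: quasi_surely_def)
  have "N \<in> null_sets m"
    using N(1) finite_acD[OF m] by (auto simp: null_sets_def pol_iff)
  then show ?thesis
    by (rule AE_I') (use N(2) finite_acD(3)[OF m] in auto)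
qed

text \<open>The exceptional event is \<open>m\<close>-null, so its trace on \<open>S\<close> is a
  null subset of the support and therefore polar.\<close>

lemma support_of_qs:
  assumes m: "finite_ac m" and S: "support_of m S" and \<phi>: "AE w in m. \<phi> w"
  shows "qs (\<lambda>w. w \<in> S \<longrightarrow> \<phi> w)"
proof -
  obtain N where N: "{w\<in>space m. \<not> \<phi> w} \<subseteq> N" "emeasure m N = 0" "N \<in> sets m"
    using AE_E[OF \<phi>] .
  have "emeasure m (N \<inter> S) = 0"
    using emeasure_mono[of "N \<inter> S" N m] N by simp
  then have "pol (N \<inter> S)"
    using S N(3) finite_acD(2)[OF m] by (auto simp: support_of_def)
  then show ?thesis
    by (rule pol_qs) (use N(1) finite_acD(3)[OF m] in auto)
qed

lemma support_of_AE:
  assumes m: "finite_ac m" and S: "support_of m S"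
  shows "AE w in m. w \<in> S"
  using S finite_acD[OF m] by (intro AE_I[of _ _ "space M - S"]) (auto simp: support_of_def)

lemma SUP_total_variation:
  assumes "R \<subseteq> prob_measures M" "N \<in> sets M"
  shows "(SUP \<nu>\<in>measure ` R. total_variation M \<nu> N) = 0 \<longleftrightarrow> (\<forall>Q\<in>R. emeasure Q N = 0)"
proof -
  have "(SUP \<nu>\<in>measure ` R. total_variation M \<nu> N) = (SUP Q\<in>R. emeasure Q N)"
    unfolding image_image using assms by (intro SUP_cong refl total_variation_measure) auto
  also have "\<dots> = 0 \<longleftrightarrow> (\<forall>Q\<in>R. emeasure Q N = 0)"
    by (auto simp: bot_ennreal[symmetric] SUP_bot_conv)
  finally show ?thesis .
qed

text \<open>Subsets of polar events are polar, so vanishing of \<open>\<mu>\<close> on polar events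
  already makes its total variation vanish there.\<close>

lemma ca_c_iff: "\<mu> \<in> ca_c M P \<longleftrightarrow> \<mu> \<in> ca M \<and> (\<forall>N. pol N \<longrightarrow> \<mu> N = 0)"
proof -
  have "abs_cont M {\<mu>} (measure ` P) \<longleftrightarrow> (\<forall>N. pol N \<longrightarrow> \<mu> N = 0)" if \<mu>: "\<mu> \<in> ca M"
  proof -
    have "abs_cont M {\<mu>} (measure ` P) \<longleftrightarrow> (\<forall>N. pol N \<longrightarrow> total_variation M \<mu> N = 0)"
      unfolding abs_cont_def using SUP_total_variation[OF P] by (auto simp: pol_iff)
    also have "\<dots> \<longleftrightarrow> (\<forall>N. pol N \<longrightarrow> \<mu> N = 0)"
      using total_variation_eq_0_iff[OF \<mu>] pol_subset by (meson pol_iff subset_refl)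
    finally show ?thesis .
  qed
  then show ?thesis
    by (auto simp: ca_c_def)
qed

text \<open>Together with \<open>finite_ac_ca_measure\<close> this makes \<open>measure\<close> and
  \<open>ca_measure M\<close> mutually inverse between \<open>finite_ac\<close> measures and
  \<open>ca_c_pos\<close>.\<close>

lemma measure_finite_ac:
  assumes m: "finite_ac m"
  shows "measure m \<in> ca_c_pos M P" "ca_measure M (measure m) = m"
proof -
  interpret finite_measure m
    using finite_acD(1)[OF m] .
  note [simp] = finite_acD(2)[OF m]
  have ca: "measure m \<in> ca M"
    using finite_measure_UNION by (auto simp: ca_def measure_notin_sets)
  then show "measure m \<in> ca_c_pos M P"
    using finite_acD(4)[OF m] by (auto simp: ca_c_pos_def ca_c_iff measure_def)
  show "ca_measure M (measure m) = m"
    by (rule measure_eqI) (simp_all add: emeasure_ca_measure[OF ca] emeasure_eq_measure)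
qed

lemma finite_ac_ca_measure:
  assumes \<mu>: "\<mu> \<in> ca_c_pos M P"
  shows "finite_ac (ca_measure M \<mu>)" "measure (ca_measure M \<mu>) = \<mu>"
proof -
  have ca: "\<mu> \<in> ca M" and pos: "\<forall>A\<in>sets M. 0 \<le> \<mu> A"
    using \<mu> by (auto simp: ca_c_pos_def ca_c_def)
  note em = emeasure_ca_measure[OF ca pos]
  have "finite_measure (ca_measure M \<mu>)"
    by (rule finite_measureI) (simp add: em sets_eq_imp_space_eq[OF sets_ca_measure])
  then show "finite_ac (ca_measure M \<mu>)"
    using ca_c_pos_null[OF P \<mu>] by (auto simp: finite_ac_def null_sets_def)
  show "measure (ca_measure M \<mu>) = \<mu>"
  proof
    fix A show "measure (ca_measure M \<mu>) A = \<mu> A"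
      using ca em[of A] pos by (cases "A \<in> sets M") (auto simp: measure_def ca_def emeasure_notin_sets)
  qed
qed

lemma ca_c_pos_eq: "ca_c_pos M P = measure ` {m. finite_ac m}"
  using measure_finite_ac(1) finite_ac_ca_measure by (auto simp: image_iff) metis

text \<open>Being supported depends on the null events only. The set function \<open>\<nu>\<close>
  is kept general so that it can be the variation of \<open>measure m\<close> as well as that of a
  signed measure.\<close>

lemma supported_iff:
  assumes m: "finite_ac m" and \<nu>: "\<And>A. A \<in> sets M \<Longrightarrow> \<nu> A = 0 \<longleftrightarrow> emeasure m A = 0"
  shows "supported M P \<nu> \<longleftrightarrow> (\<exists>S. support_of m S)"
proof -
  have "(\<forall>N\<in>sets M. \<nu> (N \<inter> S) = 0 \<longrightarrow> capacity P (N \<inter> S) = 0) \<longleftrightarrow>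
      (\<forall>N\<in>sets M. N \<subseteq> S \<longrightarrow> emeasure m N = 0 \<longrightarrow> pol N)" if "S \<in> sets M" for S
  proof (intro iffI ballI impI)
    fix N
    assume l: "\<forall>N\<in>sets M. \<nu> (N \<inter> S) = 0 \<longrightarrow> capacity P (N \<inter> S) = 0"
      and N: "N \<in> sets M" "N \<subseteq> S" "emeasure m N = 0"
    then show "pol N"
      using \<nu>[of N] l[rule_format, of N] by (simp add: Int_absorb2 polar_event_def)
  next
    fix N
    assume "\<forall>N\<in>sets M. N \<subseteq> S \<longrightarrow> emeasure m N = 0 \<longrightarrow> pol N"
      and N: "N \<in> sets M" "\<nu> (N \<inter> S) = 0"
    then have "pol (N \<inter> S)"
      using \<nu>[of "N \<inter> S"] that by simp
    then show "capacity P (N \<inter> S) = 0"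
      by (simp add: polar_event_def)
  qed
  then show ?thesis
    unfolding supported_def support_of_def using \<nu> by (metis sets.compl_sets)
qed

lemma measure_in_sca_c_iff:
  assumes m: "finite_ac m"
  shows "measure m \<in> sca_c M P \<longleftrightarrow> (\<exists>S. support_of m S)"
proof -
  interpret finite_measure m
    using finite_acD(1)[OF m] .
  have "measure m \<in> ca_c M P" and ca: "measure m \<in> ca M"
    using measure_finite_ac(1)[OF m] by (auto simp: ca_c_pos_def ca_c_def)
  moreover have "total_variation M (measure m) A = 0 \<longleftrightarrow> emeasure m A = 0" if A: "A \<in> sets M" for A
  proof -
    have "measure m B = 0" if "B \<in> sets M" "B \<subseteq> A" "measure m A = 0" for B
      using finite_measure_mono[of B A] that A finite_acD(2)[OF m] by (simp add: measure_le_0_iff)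
    then show ?thesis
      unfolding total_variation_eq_0_iff[OF ca A] using A by (auto simp: emeasure_eq_measure)
  qed
  ultimately show ?thesis
    using supported_iff[OF m, of "total_variation M (measure m)"] by (simp add: sca_c_def)
qed

lemma L0_integral_measure:
  assumes "finite_ac m" "f \<in> borel_measurable M"
  shows "L0_integral M (measure m) (cls f) = (\<integral>\<^sup>+ w. ennreal (f w) \<partial>m)"
  using L0_integral_class[OF P measure_finite_ac(1)[OF assms(1)] assms(2)]
    measure_finite_ac(2)[OF assms(1)] by simp

lemma BS2_iff: "BS2 M P C \<longleftrightarrow> C = {X\<in>L0_pos M P.
    \<forall>m\<in>{m. finite_ac m \<and> (\<forall>X\<in>C. L0_integral M (measure m) X \<le> 1)}. L0_integral M (measure m) X \<le> 1}"
  unfolding BS2_def polar_def ca_c_pos_eq by auto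

lemma BS3_iff: "BS3 M P C \<longleftrightarrow> C = {X\<in>L0_pos M P.
    \<forall>m\<in>{m. finite_ac m \<and> (\<exists>S. support_of m S) \<and> (\<forall>X\<in>C. L0_integral M (measure m) X \<le> 1)}.
      L0_integral M (measure m) X \<le> 1}"
proof -
  have "polar M P C \<inter> sca_c M P = measure ` {m. finite_ac m \<and> (\<exists>S. support_of m S) \<and>
      (\<forall>X\<in>C. L0_integral M (measure m) X \<le> 1)}"
    unfolding polar_def ca_c_pos_eq using measure_in_sca_c_iff by auto
  then show ?thesis
    unfolding BS3_def by simp
qed

section \<open>Calculus with representatives\<close>

lemma cls_in_L0: "f \<in> borel_measurable M \<Longrightarrow> cls f \<in> L0 M P"
  by (simp add: L0_def L0_class_def quotientI)

lemma L0_le_cls: "f \<in> borel_measurable M \<Longrightarrow> g \<in> borel_measurable M \<Longrightarrow>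
    L0_le M P (cls f) (cls g) \<longleftrightarrow> qs (\<lambda>w. f w \<le> g w)"
  by (rule L0_le_class[OF P])

lemma L0_zero_le_cls: "f \<in> borel_measurable M \<Longrightarrow> L0_le M P (L0_zero M P) (cls f) \<longleftrightarrow> qs (\<lambda>w. 0 \<le> f w)"
  by (simp add: L0_zero_def L0_le_cls)

lemma cls_in_L0_pos: "f \<in> borel_measurable M \<Longrightarrow> cls f \<in> L0_pos M P \<longleftrightarrow> qs (\<lambda>w. 0 \<le> f w)"
  by (simp add: L0_pos_def cls_in_L0 L0_zero_le_cls)

lemma cls_eqI: "f \<in> borel_measurable M \<Longrightarrow> g \<in> borel_measurable M \<Longrightarrow> qs (\<lambda>w. f w = g w) \<Longrightarrow> cls f = cls g"
  by (rule L0_class_eqI[OF P])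

lemma L0_diff_cls: "f \<in> borel_measurable M \<Longrightarrow> g \<in> borel_measurable M \<Longrightarrow>
    L0_diff M P (cls f) (cls g) = cls (\<lambda>w. f w - g w)"
  by (simp add: L0_diff_def L0_scale_class[OF P] L0_add_class[OF P])

text \<open>The positive part of any representative changes it on a polar event only. Nonnegativity
  everywhere keeps later pointwise estimates free of exceptional sets.\<close>

lemma L0_pos_rep:
  assumes "X \<in> L0 M P" "L0_le M P (L0_zero M P) X"
  obtains f where "f \<in> borel_measurable M" "\<And>w. 0 \<le> f w" "X = cls f"
proof -
  obtain f where f: "f \<in> borel_measurable M" "X = cls f"
    using assms(1) by (rule L0_rep)
  have "qs (\<lambda>w. 0 \<le> f w)"
    using assms(2) f by (simp add: L0_zero_le_cls)
  then have "qs (\<lambda>w. f w = max 0 (f w))"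
    by (rule qs_mp) simp
  then have "X = cls (\<lambda>w. max 0 (f w))"
    using f by (simp add: cls_eqI)
  then show ?thesis
    using f(1) by (intro that[of "\<lambda>w. max 0 (f w)"]) auto
qed

lemma L0_pos_repE:
  assumes "X \<in> L0_pos M P"
  obtains f where "f \<in> borel_measurable M" "\<And>w. 0 \<le> f w" "X = cls f"
  using assms L0_pos_rep[of X] by (auto simp: L0_pos_def)

lemma L0_solid_cls:
  assumes "L0_solid M P C" "cls f \<in> C" "f \<in> borel_measurable M" "g \<in> borel_measurable M"
    and "qs (\<lambda>w. 0 \<le> g w)" "qs (\<lambda>w. g w \<le> f w)"
  shows "cls g \<in> C"
  using assms unfolding L0_solid_def by (auto simp: cls_in_L0 L0_zero_le_cls L0_le_cls)

lemma L0_convex_cls: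
  assumes "L0_convex M P C" "cls f \<in> C" "cls g \<in> C" "0 \<le> t" "t \<le> 1"
    and [measurable]: "f \<in> borel_measurable M" "g \<in> borel_measurable M"
  shows "cls (\<lambda>w. t * f w + (1 - t) * g w) \<in> C"
proof -
  have "L0_add M P (L0_scale M P t (cls f)) (L0_scale M P (1 - t) (cls g)) \<in> C"
    using assms unfolding L0_convex_def by blast
  then show ?thesis
    by (simp add: L0_scale_class[OF P] L0_add_class[OF P])
qed

section \<open>Order closed sets: suprema, integral constraints, convergence on a support\<close>

text \<open>The differences \<open>h - f a\<close> serve as the dominating net. If \<open>z\<close>
  lies below all of them, then \<open>h - z\<close> is an upper bound of the \<open>f a\<close>, so
  \<open>least\<close> gives \<open>z \<le> 0\<close> quasi surely.\<close>

lemma order_closed_SUP: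
  assumes closed: "order_closed M P C" and dir: "directed_set I r"
    and f [measurable]: "\<And>a. a \<in> I \<Longrightarrow> f a \<in> borel_measurable M" and fC: "\<And>a. a \<in> I \<Longrightarrow> cls (f a) \<in> C"
    and h [measurable]: "h \<in> borel_measurable M"
    and mono: "\<And>a b. (a, b) \<in> r \<Longrightarrow> qs (\<lambda>w. f a w \<le> f b w)"
    and upper: "\<And>a. a \<in> I \<Longrightarrow> qs (\<lambda>w. f a w \<le> h w)"
    and least: "\<And>z. z \<in> borel_measurable M \<Longrightarrow> (\<And>a. a \<in> I \<Longrightarrow> qs (\<lambda>w. f a w \<le> z w)) \<Longrightarrow>
      qs (\<lambda>w. h w \<le> z w)"
  shows "cls h \<in> C"
proof (rule order_closedD[OF P closed dir, of "\<lambda>a. cls (f a)"])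
  have rI: "a \<in> I" "b \<in> I" if "(a, b) \<in> r" for a b
    using dir that by (auto simp: directed_set_def preorder_on_def)
  have inf: "L0_le M P Z (L0_zero M P)"
    if Z: "Z \<in> L0 M P" "\<forall>a\<in>I. L0_le M P Z (cls (\<lambda>w. h w - f a w))" for Z
  proof -
    obtain z where z [measurable]: "z \<in> borel_measurable M" and Zz: "Z = cls z"
      using Z(1) by (rule L0_rep)
    have "qs (\<lambda>w. f a w \<le> h w - z w)" if "a \<in> I" for a
    proof -
      note [measurable] = f[OF that]
      have "qs (\<lambda>w. z w \<le> h w - f a w)"
        using Z(2) that by (simp add: Zz L0_le_cls)
      then show ?thesis
        by (rule qs_mp) simp
    qed
    then have "qs (\<lambda>w. h w \<le> h w - z w)"
      by (intro least) auto
    then have "qs (\<lambda>w. z w \<le> 0)"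
      by (rule qs_mp) simp
    then show ?thesis
      by (simp add: Zz L0_zero_def L0_le_cls)
  qed
  have dec: "decreases_to_zero M P I r (\<lambda>a. cls (\<lambda>w. h w - f a w))"
    unfolding decreases_to_zero_def
  proof (intro conjI ballI impI)
    fix p assume "p \<in> r"
    then obtain a b where p: "p = (a, b)" "(a, b) \<in> r"
      by (cases p) auto
    note [measurable] = f[OF rI(1)[OF p(2)]] f[OF rI(2)[OF p(2)]]
    have "qs (\<lambda>w. h w - f b w \<le> h w - f a w)"
      using mono[OF p(2)] by (rule qs_mp) simp
    then show "case p of (a, b) \<Rightarrow> L0_le M P (cls (\<lambda>w. h w - f b w)) (cls (\<lambda>w. h w - f a w))"
      by (simp add: p(1) L0_le_cls)
  next
    fix a assume a: "a \<in> I"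
    note [measurable] = f[OF a]
    show "cls (\<lambda>w. h w - f a w) \<in> L0 M P"
      by (simp add: cls_in_L0)
    have "qs (\<lambda>w. 0 \<le> h w - f a w)"
      using upper[OF a] by (rule qs_mp) simp
    then show "L0_le M P (L0_zero M P) (cls (\<lambda>w. h w - f a w))"
      by (simp add: L0_zero_le_cls)
  qed (use inf in auto)
  have "L0_le M P (L0_abs M P (L0_diff M P (cls (f a)) (cls h))) (cls (\<lambda>w. h w - f a w))"
    if a: "a \<in> I" for a
  proof -
    note [measurable] = f[OF a]
    have "qs (\<lambda>w. \<bar>f a w - h w\<bar> \<le> h w - f a w)"
      using upper[OF a] by (rule qs_mp) simp
    then show ?thesis
      by (simp add: L0_diff_cls L0_abs_class[OF P] L0_le_cls)
  qed
  then show "order_converges M P I r (\<lambda>a. cls (f a)) (cls h)"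
    unfolding order_converges_def using dec f h by (auto simp: cls_in_L0)
qed (use fC in auto)


text \<open>On a support, a.e. lower bounds of the dominating net are quasi sure lower bounds, so
  the net has essential infimum 0 under each \<open>m\<close> as well. By
  \<open>directed_inf_integral\<close> the truncated error is then small in mean for a suitable
  index, and the bound 1 passes to the limit.\<close>

lemma order_closed_integral_le:
  assumes \<M>: "\<And>m. m \<in> \<M> \<Longrightarrow> finite_ac m \<and> (\<exists>S. support_of m S)"
    and C: "C = {X\<in>L0_pos M P. \<forall>m\<in>\<M>. L0_integral M (measure m) X \<le> 1}"
  shows "order_closed M P C"
  unfolding order_closed_def
proof (intro allI impI)
  fix I :: "('a \<Rightarrow> real) set set" and r X L
  assume dir: "directed_set I r" and XC: "\<forall>a\<in>I. X a \<in> C" and conv: "order_converges M P I r X L"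
  obtain Y where Y: "decreases_to_zero M P I r Y"
    and le: "\<And>a. a \<in> I \<Longrightarrow> L0_le M P (L0_abs M P (L0_diff M P (X a) L)) (Y a)"
    using conv by (auto simp: order_converges_def)
  have "L \<in> L0 M P"
    using conv by (simp add: order_converges_def)
  then obtain l where l [measurable]: "l \<in> borel_measurable M" and L: "L = cls l"
    by (rule L0_rep)
  have "\<exists>f. f \<in> borel_measurable M \<and> (\<forall>w. 0 \<le> f w) \<and> X a = cls f" if "a \<in> I" for a
  proof -
    have "X a \<in> L0_pos M P"
      using XC that by (simp add: C)
    then show ?thesis
      by (rule L0_pos_repE) blast
  qed
  then obtain f where f [measurable]: "\<And>a. a \<in> I \<Longrightarrow> f a \<in> borel_measurable M"
    and f0: "\<And>a w. a \<in> I \<Longrightarrow> 0 \<le> f a w" and Xf: "\<And>a. a \<in> I \<Longrightarrow> X a = cls (f a)"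
    by metis
  have "\<exists>y. y \<in> borel_measurable M \<and> (\<forall>w. 0 \<le> y w) \<and> Y a = cls y" if "a \<in> I" for a
  proof -
    have "Y a \<in> L0 M P" "L0_le M P (L0_zero M P) (Y a)"
      using Y that by (simp_all add: decreases_to_zero_def)
    then show ?thesis
      by (rule L0_pos_rep) blast
  qed
  then obtain y where y [measurable]: "\<And>a. a \<in> I \<Longrightarrow> y a \<in> borel_measurable M"
    and y0: "\<And>a w. a \<in> I \<Longrightarrow> 0 \<le> y a w" and Yy: "\<And>a. a \<in> I \<Longrightarrow> Y a = cls (y a)"
    by metis
  have close: "qs (\<lambda>w. \<bar>f a w - l w\<bar> \<le> y a w)" if a: "a \<in> I" for a
  proof -
    note [measurable] = f[OF a] y[OF a]
    show ?thesis
      using le[OF a] by (simp add: Xf[OF a] Yy[OF a] L L0_diff_cls L0_abs_class[OF P] L0_le_cls)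
  qed
  have inf: "qs (\<lambda>w. z w \<le> 0)"
    if z: "z \<in> borel_measurable M" "\<And>a. a \<in> I \<Longrightarrow> qs (\<lambda>w. z w \<le> y a w)" for z
  proof -
    have "\<forall>a\<in>I. L0_le M P (cls z) (Y a)"
      using z y by (simp add: Yy L0_le_cls)
    then have "L0_le M P (cls z) (L0_zero M P)"
      using Y z(1) by (simp add: decreases_to_zero_def cls_in_L0)
    then show ?thesis
      using z(1) by (simp add: L0_zero_def L0_le_cls)
  qed
  \<comment> \<open>Since \<open>f a\<close> is nonnegative, \<open>- l\<close> is a lower bound of
    the dominating net; this yields positivity of the limit.\<close>
  have "qs (\<lambda>w. - l w \<le> y a w)" if a: "a \<in> I" for a
    using close[OF a]
  proof (rule qs_mp)
    fix w assume "\<bar>f a w - l w\<bar> \<le> y a w"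
    with f0[OF a, of w] show "- l w \<le> y a w"
      by linarith
  qed
  then have "qs (\<lambda>w. - l w \<le> 0)"
    by (intro inf) auto
  then have "qs (\<lambda>w. 0 \<le> l w)"
    by (rule qs_mp) simp
  then have L_pos: "L \<in> L0_pos M P"
    by (simp add: L cls_in_L0_pos)
  have "L0_integral M (measure m) L \<le> 1" if m\<M>: "m \<in> \<M>" for m
  proof -
    obtain S where m: "finite_ac m" and S: "support_of m S"
      using \<M>[OF m\<M>] by auto
    note meas_m = measurable_finite_ac[OF m]
    interpret finite_measure m
      using finite_acD(1)[OF m] .
    have SM [measurable]: "S \<in> sets M"
      using S by (simp add: support_of_def)
    have inf_AE: "AE w in m. z w \<le> 0"
      if z: "z \<in> borel_measurable m" "\<And>a. a \<in> I \<Longrightarrow> AE w in m. z w \<le> y a w" for z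
    proof -
      have [measurable]: "z \<in> borel_measurable M"
        using z(1) by (simp add: meas_m)
      \<comment> \<open>On \<open>S\<close> the a.e. bound is a quasi sure one, and off
        \<open>S\<close> the left side is 0, which the nonnegative \<open>y a\<close>
        dominates.\<close>
      have "qs (\<lambda>w. z w * indicator S w \<le> y a w)" if a: "a \<in> I" for a
        using support_of_qs[OF m S z(2)[OF a]]
        by (rule qs_mp) (use y0[OF a] in \<open>auto simp: indicator_def\<close>)
      then have "qs (\<lambda>w. z w * indicator S w \<le> 0)"
        by (intro inf) auto
      then have "AE w in m. z w * indicator S w \<le> 0"
        by (rule qs_AE[OF m])
      with support_of_AE[OF m S] show ?thesis
        by eventually_elim simp
    qed
    have trunc: "(\<integral>\<^sup>+ w. ennreal (min (l w) (real n)) \<partial>m) \<le> 1" for n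
    proof (rule ennreal_le_epsilon)
      fix e :: real assume "0 < e"
      have "\<exists>a\<in>I. (\<integral>w. min (real n) (y a w) \<partial>m) < e"
      proof (rule directed_inf_integral)
        show "y a \<in> borel_measurable m" if "a \<in> I" for a
          using y[OF that] by (simp add: meas_m)
        show "I \<noteq> {}"
          using dir by (simp add: directed_set_def)
        fix a b assume ab: "a \<in> I" "b \<in> I"
        obtain c where c: "c \<in> I" "(a, c) \<in> r" "(b, c) \<in> r"
          using dir ab by (auto simp: directed_set_def)
        have "qs (\<lambda>w. y c w \<le> y a w)" if "a \<in> I" "(a, c) \<in> r" for a
          using Y that c(1) y by (auto simp: decreases_to_zero_def Yy L0_le_cls dest!: bspec)
        with ab c show "\<exists>c\<in>I. (AE w in m. y c w \<le> y a w) \<and> (AE w in m. y c w \<le> y b w)"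
          by (intro bexI[of _ c] conjI qs_AE[OF m]) auto
      qed (use y0 inf_AE \<open>0 < e\<close> in auto)
      then obtain a where a: "a \<in> I" "(\<integral>w. min (real n) (y a w) \<partial>m) < e"
        by blast
      have [measurable]: "y a \<in> borel_measurable m" "f a \<in> borel_measurable m"
        using y[OF a(1)] f[OF a(1)] by (simp_all add: meas_m)
      have "(\<integral>\<^sup>+ w. ennreal (min (l w) (real n)) \<partial>m)
          \<le> (\<integral>\<^sup>+ w. ennreal (f a w) + ennreal (min (real n) (y a w)) \<partial>m)"
      proof (rule nn_integral_mono_AE)
        show "AE w in m. ennreal (min (l w) (real n)) \<le> ennreal (f a w) + ennreal (min (real n) (y a w))"
          using qs_AE[OF m close[OF a(1)]]
        proof eventually_elim
          fix w assume "\<bar>f a w - l w\<bar> \<le> y a w"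
          \<comment> \<open>As \<open>l \<le> f a + y a\<close> and \<open>f a\<close> is
            nonnegative, the truncation can be moved onto \<open>y a\<close>, the form that
            \<open>directed_inf_integral\<close> controls.\<close>
          then have "min (l w) (real n) \<le> f a w + min (real n) (y a w)"
            using f0[OF a(1), of w] by linarith
          then show "ennreal (min (l w) (real n)) \<le> ennreal (f a w) + ennreal (min (real n) (y a w))"
            using f0[OF a(1), of w] y0[OF a(1), of w]
            by (simp add: ennreal_leI flip: ennreal_plus)
        qed
      qed
      also have "\<dots> = (\<integral>\<^sup>+ w. ennreal (f a w) \<partial>m) + (\<integral>\<^sup>+ w. ennreal (min (real n) (y a w)) \<partial>m)"
        by (rule nn_integral_add) auto
      also have "(\<integral>\<^sup>+ w. ennreal (f a w) \<partial>m) \<le> 1"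
        using XC a(1) m\<M> f[OF a(1)] by (simp add: C Xf L0_integral_measure[OF m, symmetric])
      also have "(\<integral>\<^sup>+ w. ennreal (min (real n) (y a w)) \<partial>m) = ennreal (\<integral>w. min (real n) (y a w) \<partial>m)"
      proof (rule nn_integral_eq_integral)
        show "integrable m (\<lambda>w. min (real n) (y a w))"
          using y0[OF a(1)] by (intro integrable_const_bound[of _ "real n"]) auto
      qed (use y0[OF a(1)] in auto)
      also have "\<dots> \<le> ennreal e"
        using a(2) by (intro ennreal_leI) auto
      finally show "(\<integral>\<^sup>+ w. ennreal (min (l w) (real n)) \<partial>m) \<le> 1 + ennreal e"
        by (simp add: add_mono)
    qed
    have "(\<integral>\<^sup>+ w. ennreal (l w) \<partial>m) \<le> 1"
    proof (rule nn_integral_le_LIMSEQ[OF _ _ trunc])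
      show "(\<lambda>n. ennreal (min (l w) (real n))) \<longlonglongrightarrow> ennreal (l w)" for w
        by (intro tendsto_intros LIMSEQ_min_nat)
      show "(\<lambda>w. ennreal (min (l w) (real n))) \<in> borel_measurable m" for n
        unfolding meas_m by measurable
    qed
    then show ?thesis
      by (simp add: L L0_integral_measure[OF m l])
  qed
  with L_pos show "L \<in> C"
    by (simp add: C)
qed

text \<open>The tail infima \<open>g n\<close> increase and lie below \<open>f n\<close>, so
  solidity keeps their restrictions in \<open>C\<close>. The convergence is quasi sure on
  \<open>S\<close>, which makes \<open>h\<close> the supremum of the \<open>g n\<close> there, and
  \<open>order_closed_SUP\<close> applies.\<close>

lemma closed_on_support:
  assumes closed: "order_closed M P C" and solid: "L0_solid M P C"
    and m: "finite_ac m" and S: "support_of m S"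
    and f [measurable]: "\<And>n::nat. f n \<in> borel_measurable M" and f0: "\<And>n w. 0 \<le> f n w"
    and fC: "\<And>n. cls (\<lambda>w. f n w * indicator S w) \<in> C"
    and h [measurable]: "h \<in> borel_measurable M"
    and lim: "AE w in m. (\<lambda>n. f n w) \<longlonglongrightarrow> h w"
  shows "cls (\<lambda>w. h w * indicator S w) \<in> C"
proof -
  have [measurable]: "S \<in> sets M"
    using S by (simp add: support_of_def)
  define g where "g n w = (INF k\<in>{n..}. f k w)" for n w
  have bdd: "bdd_below ((\<lambda>k. f k w) ` {n..})" for n w
    using f0 by (intro bdd_belowI2)
  have g_meas [measurable]: "g n \<in> borel_measurable M" for n
    unfolding g_def using bdd by (intro borel_measurable_cINF) auto
  have g0: "0 \<le> g n w" for n w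
    unfolding g_def using f0 by (intro cINF_greatest) auto
  have g_le: "g n w \<le> f k w" if "n \<le> k" for n k w
    unfolding g_def using bdd that by (intro cINF_lower) auto
  have g_mono: "g i w \<le> g j w" if "i \<le> j" for i j w
    unfolding g_def[of j] using that by (intro cINF_greatest g_le) auto
  have qs_lim: "qs (\<lambda>w. w \<in> S \<longrightarrow> (\<lambda>n. f n w) \<longlonglongrightarrow> h w)"
    by (rule support_of_qs[OF m S lim])
  show ?thesis
  proof (rule order_closed_SUP[OF closed, of UNIV "{(i, j). i \<le> j}" "\<lambda>n w. g n w * indicator S w"])
    show "directed_set (UNIV :: nat set) {(i, j). i \<le> j}"
      by (auto simp: directed_set_def preorder_on_def refl_on_def trans_def) (meson nat_le_linear order_refl)
    show "cls (\<lambda>w. g n w * indicator S w) \<in> C" for n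
      using g0 g_le[of n n] by (intro L0_solid_cls[OF solid fC[of n]] quasi_surelyI)
        (auto simp: indicator_def)
    show "qs (\<lambda>w. g i w * indicator S w \<le> g j w * indicator S w)" if "(i, j) \<in> {(i, j). i \<le> j}" for i j
      using g_mono that by (intro quasi_surelyI) (auto simp: indicator_def)
    show "qs (\<lambda>w. g n w * indicator S w \<le> h w * indicator S w)" for n
      using qs_lim
    proof (rule qs_mp)
      fix w assume l: "w \<in> S \<longrightarrow> (\<lambda>n. f n w) \<longlonglongrightarrow> h w"
      have "g n w \<le> h w" if "w \<in> S"
        using l that g_le[of n _ w] by (intro LIMSEQ_le_const[of "\<lambda>n. f n w"]) auto
      then show "g n w * indicator S w \<le> h w * indicator S w"
        by (auto simp: indicator_def)
    qed
    fix z assume "\<And>n. n \<in> UNIV \<Longrightarrow> qs (\<lambda>w. g n w * indicator S w \<le> z w)"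
    then have "qs (\<lambda>w. \<forall>n. g n w * indicator S w \<le> z w)"
      by (intro qs_all) auto
    from this qs_lim show "qs (\<lambda>w. h w * indicator S w \<le> z w)"
    proof (rule qs_mp2)
      fix w assume le: "\<forall>n. g n w * indicator S w \<le> z w" and l: "w \<in> S \<longrightarrow> (\<lambda>n. f n w) \<longlonglongrightarrow> h w"
      show "h w * indicator S w \<le> z w"
      proof (cases "w \<in> S")
        case True
        \<comment> \<open>From some index on all \<open>f k w\<close> exceed \<open>h w - e\<close>,
          so the tail infimum at that index does not fall below this value.\<close>
        have "h w \<le> z w + e" if "0 < e" for e
        proof -
          have "\<forall>\<^sub>F n in sequentially. h w - e < f n w"
            using l True that by (intro order_tendstoD(1)) auto
          then obtain n where "\<forall>k\<ge>n. h w - e < f k w"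
            by (auto simp: eventually_sequentially)
          then have "h w - e \<le> g n w"
            unfolding g_def by (intro cINF_greatest) (auto intro: less_imp_le)
          with le True show ?thesis
            by (auto dest!: spec[of _ n])
        qed
        then show ?thesis
          using True by (auto intro: field_le_epsilon)
      qed (use le in auto)
    qed
  qed auto
qed

text \<open>The sum of the two measures works: its null events are the common null events, so a null
  subset of the union splits into one polar part on each support.\<close>

lemma support_of_Un:
  assumes "finite_ac m1" "support_of m1 S1" "finite_ac m2" "support_of m2 S2"
  obtains m where "finite_ac m" "support_of m (S1 \<union> S2)"
proof -
  have c: "measure m1 \<in> ca_c_pos M P" "measure m2 \<in> ca_c_pos M P"
    using assms measure_finite_ac by auto
  define \<mu> where "\<mu> A = measure m1 A + measure m2 A" for A
  have \<mu>: "\<mu> \<in> ca_c_pos M P"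
    using c by (auto simp: ca_c_pos_def ca_c_iff ca_def \<mu>_def intro!: sums_add)
  define m where "m = ca_measure M \<mu>"
  have m: "finite_ac m" "measure m = \<mu>"
    unfolding m_def using finite_ac_ca_measure[OF \<mu>] by auto
  interpret m: finite_measure m
    using finite_acD(1)[OF m(1)] .
  interpret m1: finite_measure m1
    using finite_acD(1)[OF assms(1)] .
  interpret m2: finite_measure m2
    using finite_acD(1)[OF assms(3)] .
  have zero: "emeasure m A = 0 \<longleftrightarrow> emeasure m1 A = 0 \<and> emeasure m2 A = 0" for A
    by (simp add: m.emeasure_eq_measure m1.emeasure_eq_measure m2.emeasure_eq_measure m(2) \<mu>_def
        add_nonneg_eq_0_iff)
  have "support_of m (S1 \<union> S2)"
    unfolding support_of_def
  proof (intro conjI ballI impI)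
    have S: "S1 \<in> sets M" "S2 \<in> sets M" "emeasure m1 (space M - S1) = 0" "emeasure m2 (space M - S2) = 0"
      using assms by (auto simp: support_of_def)
    then show "S1 \<union> S2 \<in> sets M"
      by auto
    have "emeasure m1 (space M - (S1 \<union> S2)) \<le> emeasure m1 (space M - S1)"
      using S finite_acD[OF assms(1)] by (intro emeasure_mono) auto
    moreover have "emeasure m2 (space M - (S1 \<union> S2)) \<le> emeasure m2 (space M - S2)"
      using S finite_acD[OF assms(3)] by (intro emeasure_mono) auto
    ultimately show "emeasure m (space M - (S1 \<union> S2)) = 0"
      using S by (simp add: zero)
    fix N assume N: "N \<in> sets M" "N \<subseteq> S1 \<union> S2" "emeasure m N = 0"
    have "emeasure m1 (N \<inter> S1) \<le> emeasure m1 N" "emeasure m2 (N \<inter> S2) \<le> emeasure m2 N"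
      using N(1) finite_acD(2)[OF assms(1)] finite_acD(2)[OF assms(3)] by (auto intro!: emeasure_mono)
    then have "pol (N \<inter> S1)" "pol (N \<inter> S2)"
      using N S assms(2,4) by (auto simp: zero support_of_def)
    then have "pol (N \<inter> S1 \<union> N \<inter> S2)"
      by (rule polar_event_Un[OF P])
    then show "pol N"
      using N(2) by (simp add: Int_absorb2 flip: Int_Un_distrib)
  qed
  with m(1) show ?thesis
    by (rule that)
qed


section \<open>Equivalences for convex solid sets\<close>

text \<open>\<open>bipolar_separation\<close> over \<open>m\<close> yields a bounded density
  \<open>g\<close>. The measure with this density is again supported, by the part of
  \<open>S\<close> where \<open>g\<close> is positive, because there its null events are
  \<open>m\<close>-null.\<close>

lemma separation_on_support:
  assumes closed: "order_closed M P C" and solid: "L0_solid M P C" and convex: "L0_convex M P C"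
    and C: "C \<noteq> {}" "C \<subseteq> L0_pos M P"
    and m: "finite_ac m" and S: "support_of m S"
    and x [measurable]: "x \<in> borel_measurable M" and x0: "\<And>w. 0 \<le> x w"
    and xC: "cls (\<lambda>w. x w * indicator S w) \<notin> C"
  obtains n T where "finite_ac n" "support_of n T" "\<forall>X\<in>C. L0_integral M (measure n) X \<le> 1"
    "1 < L0_integral M (measure n) (cls x)"
proof -
  interpret finite_measure m
    using finite_acD(1)[OF m] .
  have SM [measurable]: "S \<in> sets M"
    using S by (simp add: support_of_def)
  note meas_m = measurable_finite_ac[OF m]
  \<comment> \<open>Testing only the restriction to \<open>S\<close> makes membership insensitive to
    changes on \<open>m\<close>-null events, since these are polar inside \<open>S\<close>.\<close>
  define D where "D = {f \<in> borel_measurable m. (\<forall>w. 0 \<le> f w) \<and> cls (\<lambda>w. f w * indicator S w) \<in> C}"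
  obtain X where X: "X \<in> C"
    using C(1) by auto
  then obtain e where e: "e \<in> borel_measurable M" "\<forall>w. 0 \<le> e w" "X = cls e"
    using C(2) L0_pos_repE[of X] by (metis subsetD)
  have restrict: "f \<in> D" if f: "f \<in> borel_measurable M" "\<And>w. 0 \<le> f w" "cls f \<in> C" for f
  proof -
    have [measurable]: "f \<in> borel_measurable M"
      by fact
    have "cls (\<lambda>w. f w * indicator S w) \<in> C"
      using f(2) by (intro L0_solid_cls[OF solid f(3)] quasi_surelyI) (auto simp: indicator_def)
    with f show ?thesis
      by (simp add: D_def meas_m)
  qed
  obtain g B where g: "g \<in> borel_measurable m" and g0: "\<And>w. 0 \<le> g w" and gB: "\<And>w. g w \<le> B"
    and gD: "\<And>f. f \<in> D \<Longrightarrow> (\<integral>\<^sup>+ w. ennreal (g w * f w) \<partial>m) \<le> 1"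
    and gx: "1 < (\<integral>\<^sup>+ w. ennreal (g w * x w) \<partial>m)"
  proof (rule bipolar_separation[of D x])
    show "D \<noteq> {}"
      using restrict[of e] e X by auto
    show "x \<in> borel_measurable m"
      by (simp add: meas_m)
    show "x \<notin> D"
      using xC by (simp add: D_def)
    show "g \<in> D" if "f \<in> D" "g \<in> borel_measurable m" "\<And>w. 0 \<le> g w \<and> g w \<le> f w" for f g
    proof -
      have [measurable]: "f \<in> borel_measurable M" "g \<in> borel_measurable M"
        using that by (auto simp: D_def meas_m)
      have fC: "cls (\<lambda>w. f w * indicator S w) \<in> C"
        using that(1) by (simp add: D_def)
      have "cls (\<lambda>w. g w * indicator S w) \<in> C"
        using that(3) by (intro L0_solid_cls[OF solid fC] quasi_surelyI) (auto simp: indicator_def)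
      with that show ?thesis
        by (simp add: D_def)
    qed
    show "(\<lambda>w. t * f w + (1 - t) * g w) \<in> D" if "f \<in> D" "g \<in> D" "0 \<le> t" "t \<le> 1" for f g t
    proof -
      have [measurable]: "f \<in> borel_measurable M" "g \<in> borel_measurable M"
        using that by (auto simp: D_def meas_m)
      have "cls (\<lambda>w. t * (f w * indicator S w) + (1 - t) * (g w * indicator S w)) \<in> C"
        by (rule L0_convex_cls[OF convex]) (use that in \<open>auto simp: D_def\<close>)
      then have "cls (\<lambda>w. (t * f w + (1 - t) * g w) * indicator S w) \<in> C"
        by (simp add: algebra_simps)
      with that show ?thesis
        by (simp add: D_def meas_m)
    qed
    show "h \<in> D" if "\<And>n::nat. f n \<in> D" "h \<in> borel_measurable m" "\<And>w. 0 \<le> h w"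
      "AE w in m. (\<lambda>n. f n w) \<longlonglongrightarrow> h w" for f h
    proof -
      have "cls (\<lambda>w. h w * indicator S w) \<in> C"
        by (rule closed_on_support[OF closed solid m S _ _ _ _ that(4)])
          (use that(1,2) in \<open>auto simp: D_def meas_m\<close>)
      with that show ?thesis
        by (simp add: D_def)
    qed
  qed (use x0 in \<open>auto simp: D_def\<close>)
  have [measurable]: "g \<in> borel_measurable M"
    using g by (simp add: meas_m)
  define n where "n = density m (\<lambda>w. ennreal (g w))"
  \<comment> \<open>\<open>n\<close> does not charge the zero set of \<open>g\<close>, where
    non-polar subsets of \<open>S\<close> may lie; hence this set is left out.\<close>
  define T where "T = S \<inter> {w\<in>space M. 0 < g w}"
  have TM [measurable]: "T \<in> sets M"
    unfolding T_def by measurable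
  have sets_n: "sets n = sets M" and space_n: "space n = space M"
    using finite_acD[OF m] by (simp_all add: n_def)
  have n_zero: "emeasure n A = 0 \<longleftrightarrow> (AE w in m. w \<in> A \<longrightarrow> g w \<le> 0)" if "A \<in> sets M" for A
  proof -
    have "emeasure n A = 0 \<longleftrightarrow> (AE w in m. w \<in> A \<longrightarrow> ennreal (g w) = 0)"
      using that g null_sets_density_iff[of "\<lambda>w. ennreal (g w)" m A] sets_n finite_acD(2)[OF m]
      by (auto simp: n_def null_sets_def)
    then show ?thesis
      by (simp add: ennreal_eq_0_iff)
  qed
  have "finite_measure n"
  proof (rule finite_measureI)
    have "emeasure n (space n) = (\<integral>\<^sup>+ w. ennreal (g w) * indicator (space m) w \<partial>m)"
      using g by (simp add: n_def emeasure_density)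
    also have "\<dots> \<le> (\<integral>\<^sup>+ w. ennreal B \<partial>m)"
      using gB by (intro nn_integral_mono) (auto simp: indicator_def intro: ennreal_leI)
    also have "\<dots> < \<infinity>"
      by (simp add: ennreal_mult_less_top emeasure_eq_measure)
    finally show "emeasure n (space n) \<noteq> \<infinity>"
      by simp
  qed
  moreover have "emeasure n N = 0" if "pol N" for N
  proof -
    have N: "N \<in> sets m" "emeasure m N = 0"
      using that finite_acD[OF m] by (auto simp: pol_iff)
    then have "AE w in m. w \<notin> N"
      by (intro AE_not_in) (auto simp: null_sets_def)
    with N show ?thesis
      using finite_acD(2)[OF m] by (subst n_zero) (auto elim: eventually_mono)
  qed
  ultimately have n: "finite_ac n"
    by (simp add: finite_ac_def sets_n)
  have nT: "support_of n T"
    unfolding support_of_def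
  proof (intro conjI ballI impI)
    show "emeasure n (space M - T) = 0"
      using support_of_AE[OF m S] by (subst n_zero) (auto simp: T_def elim!: eventually_mono)
    fix N assume N: "N \<in> sets M" "N \<subseteq> T" "emeasure n N = 0"
    have "AE w in m. w \<notin> N"
      using N(3) unfolding n_zero[OF N(1)] by eventually_elim (use N(2) in \<open>auto simp: T_def\<close>)
    then have "emeasure m N = 0"
      using N(1) finite_acD(2)[OF m] AE_iff_null_sets[of N m] by (auto simp: null_sets_def)
    then show "pol N"
      using S N by (auto simp: support_of_def T_def)
  qed (rule TM)
  have integral_n: "L0_integral M (measure n) (cls f) = (\<integral>\<^sup>+ w. ennreal (g w * f w) \<partial>m)"
    if f: "f \<in> borel_measurable M" for f
  proof -
    have "(\<integral>\<^sup>+ w. ennreal (f w) \<partial>n) = (\<integral>\<^sup>+ w. ennreal (g w) * ennreal (f w) \<partial>m)"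
      using g f unfolding n_def by (intro nn_integral_density) (auto simp: meas_m)
    then show ?thesis
      using g0 by (simp add: L0_integral_measure[OF n f] ennreal_mult')
  qed
  show ?thesis
  proof (rule that[OF n nT])
    show "\<forall>X\<in>C. L0_integral M (measure n) X \<le> 1"
    proof
      fix X assume XC: "X \<in> C"
      then obtain f where f: "f \<in> borel_measurable M" "\<forall>w. 0 \<le> f w" "X = cls f"
        using C(2) L0_pos_repE[of X] by (metis subsetD)
      then show "L0_integral M (measure n) X \<le> 1"
        using gD[OF restrict[of f]] XC integral_n[OF f(1)] by simp
    qed
    show "1 < L0_integral M (measure n) (cls x)"
      using gx integral_n[OF x] by simp
  qed
qed

section \<open>Class (S) and the bipolar property (BS3)\<close>

lemma class_S_D:
  assumes "class_S M P"
  obtains R where "R \<subseteq> prob_measures M" "\<And>Q. Q \<in> R \<Longrightarrow> finite_ac Q \<and> (\<exists>S. support_of Q S)"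
    "\<And>N. N \<in> sets M \<Longrightarrow> (\<And>Q. Q \<in> R \<Longrightarrow> emeasure Q N = 0) \<Longrightarrow> pol N"
proof -
  obtain R where R: "R \<subseteq> prob_measures M" "equiv_cont M (measure ` R) (measure ` P)"
    "measure ` R \<subseteq> sca_c M P"
    using assms by (auto simp: class_S_def)
  have "finite_ac Q \<and> (\<exists>S. support_of Q S)" if Q: "Q \<in> R" for Q
  proof -
    interpret prob_space Q
      using Q R(1) by (auto simp: prob_measures_def)
    have "measure Q \<in> sca_c M P"
      using Q R(3) by auto
    moreover from this have "measure Q \<in> ca_c M P"
      by (simp add: sca_c_def)
    then have "finite_ac Q"
      using Q R(1) finite_measure_axioms
      by (auto simp: finite_ac_def ca_c_iff prob_measures_def emeasure_eq_measure)
    ultimately show ?thesis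
      using measure_in_sca_c_iff by blast
  qed
  moreover have "pol N" if "N \<in> sets M" "\<And>Q. Q \<in> R \<Longrightarrow> emeasure Q N = 0" for N
  proof -
    have "(SUP \<nu>\<in>measure ` R. total_variation M \<nu> N) = 0"
      using SUP_total_variation[OF R(1) that(1)] that(2) by blast
    then have "(SUP \<nu>\<in>measure ` P. total_variation M \<nu> N) = 0"
      using R(2) that(1) unfolding equiv_cont_def abs_cont_def by blast
    then show ?thesis
      using SUP_total_variation[OF P that(1)] that(1) by (simp add: pol_iff)
  qed
  ultimately show ?thesis
    using R(1) by (intro that) auto
qed

text \<open>If \<open>x\<close> meets all constraints, \<open>separation_on_support\<close> puts its
  restriction to every support into \<open>C\<close>. Supports are directed by inclusion. Under
  class (S) \<open>x\<close> is the supremum of these restrictions: if \<open>z\<close> dominates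
  them all, the event \<open>z < x\<close> is null for every measure in \<open>R\<close>, hence
  polar.\<close>

lemma class_S_imp_BS3:
  assumes S: "class_S M P" and closed: "order_closed M P C" and solid: "L0_solid M P C"
    and convex: "L0_convex M P C" and C: "C \<noteq> {}" "C \<subseteq> L0_pos M P"
  shows "BS3 M P C"
proof -
  obtain R where R: "R \<subseteq> prob_measures M" and R_supp: "\<And>Q. Q \<in> R \<Longrightarrow> finite_ac Q \<and> (\<exists>S. support_of Q S)"
    and R_pol: "\<And>N. N \<in> sets M \<Longrightarrow> (\<And>Q. Q \<in> R \<Longrightarrow> emeasure Q N = 0) \<Longrightarrow> pol N"
    using class_S_D[OF S] by metis
  define \<M> where "\<M> = {m. finite_ac m \<and> (\<exists>S. support_of m S) \<and> (\<forall>X\<in>C. L0_integral M (measure m) X \<le> 1)}"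
  have "X \<in> C" if X: "X \<in> L0_pos M P" and le: "\<forall>m\<in>\<M>. L0_integral M (measure m) X \<le> 1" for X
  proof -
    obtain x where x: "x \<in> borel_measurable M" and x0: "\<forall>w. 0 \<le> x w" and Xx: "X = cls x"
      using L0_pos_repE[OF X] by metis
    note [measurable] = x
    define I where "I = {S. \<exists>m. finite_ac m \<and> support_of m S}"
    have IM: "S \<in> sets M" if "S \<in> I" for S
      using that by (auto simp: I_def support_of_def)
    have "cls x \<in> C"
    proof (rule order_closed_SUP[OF closed, of I "{(S, T). S \<in> I \<and> T \<in> I \<and> S \<subseteq> T}"
          "\<lambda>S w. x w * indicator S w"])
      show "directed_set I {(S, T). S \<in> I \<and> T \<in> I \<and> S \<subseteq> T}"
        unfolding directed_set_def
      proof (intro conjI ballI)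
        \<comment> \<open>The zero measure has empty support, which makes the index set
          nonempty.\<close>
        have "finite_ac (null_measure M)" "support_of (null_measure M) {}"
          by (auto simp: finite_ac_def support_of_def pol_iff P_nonempty intro!: finite_measureI)
        then show "I \<noteq> {}"
          unfolding I_def by blast
        show "preorder_on I {(S, T). S \<in> I \<and> T \<in> I \<and> S \<subseteq> T}"
          by (auto simp: preorder_on_def refl_on_def trans_def)
        fix S T assume ST: "S \<in> I" "T \<in> I"
        obtain m1 m2 where "finite_ac m1" "support_of m1 S" "finite_ac m2" "support_of m2 T"
          using ST by (auto simp: I_def)
        then obtain m where "finite_ac m" "support_of m (S \<union> T)"
          by (rule support_of_Un)
        then have "S \<union> T \<in> I"
          by (auto simp: I_def)
        with ST show "\<exists>U\<in>I. (S, U) \<in> {(S, T). S \<in> I \<and> T \<in> I \<and> S \<subseteq> T} \<and>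
            (T, U) \<in> {(S, T). S \<in> I \<and> T \<in> I \<and> S \<subseteq> T}"
          by (intro bexI[of _ "S \<union> T"]) auto
      qed
    next
      fix S assume SI: "S \<in> I"
      have [measurable]: "S \<in> sets M"
        by (rule IM[OF SI])
      show "(\<lambda>w. x w * indicator S w) \<in> borel_measurable M"
        by measurable
      show "qs (\<lambda>w. x w * indicator S w \<le> x w)"
        using x0 by (intro quasi_surelyI) (auto simp: indicator_def)
      obtain m where m: "finite_ac m" "support_of m S"
        using SI by (auto simp: I_def)
      show "cls (\<lambda>w. x w * indicator S w) \<in> C"
      proof (rule ccontr)
        assume "cls (\<lambda>w. x w * indicator S w) \<notin> C"
        then obtain n T where n: "finite_ac n" "support_of n T" "\<forall>X\<in>C. L0_integral M (measure n) X \<le> 1"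
          "1 < L0_integral M (measure n) (cls x)"
          using separation_on_support[OF closed solid convex C m x] x0 by metis
        then have "n \<in> \<M>"
          by (auto simp: \<M>_def)
        with le n(4) show False
          by (simp add: Xx leD)
      qed
    next
      fix S T assume "(S, T) \<in> {(S, T). S \<in> I \<and> T \<in> I \<and> S \<subseteq> T}"
      then show "qs (\<lambda>w. x w * indicator S w \<le> x w * indicator T w)"
        using x0 by (intro quasi_surelyI) (auto simp: indicator_def)
    next
      fix z assume z [measurable]: "z \<in> borel_measurable M"
        and upper: "\<And>S. S \<in> I \<Longrightarrow> qs (\<lambda>w. x w * indicator S w \<le> z w)"
      define N where "N = {w\<in>space M. z w < x w}"
      have NM [measurable]: "N \<in> sets M"
        unfolding N_def by measurable
      have "pol N"
      proof (rule R_pol[OF NM])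
        fix Q assume "Q \<in> R"
        then obtain S where Q: "finite_ac Q" and S: "support_of Q S"
          using R_supp by blast
        have SI: "S \<in> I"
          using Q S by (auto simp: I_def)
        have SM: "S \<in> sets M"
          by (rule IM[OF SI])
        have "pol (N \<inter> S)"
          using upper[OF SI] by (rule qs_pol) (use SM NM in \<open>auto simp: N_def\<close>)
        then have "emeasure Q (N \<inter> S) = 0"
          by (rule finite_acD(4)[OF Q])
        moreover have "emeasure Q (N - S) \<le> emeasure Q (space M - S)"
          using SM finite_acD(2)[OF Q] sets.sets_into_space[OF NM] by (intro emeasure_mono) auto
        then have "emeasure Q (N - S) = 0"
          using S by (simp add: support_of_def)
        moreover have "emeasure Q N = emeasure Q (N \<inter> S) + emeasure Q (N - S)"
          using SM NM finite_acD(2)[OF Q] by (subst plus_emeasure) (auto simp: Int_Diff_Un)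
        ultimately show "emeasure Q N = 0"
          by simp
      qed
      then show "qs (\<lambda>w. x w \<le> z w)"
        by (rule pol_qs) (auto simp: N_def)
    qed (rule x)
    then show ?thesis
      by (simp add: Xx)
  qed
  then show ?thesis
    unfolding BS3_iff \<M>_def[symmetric] using C(2) by (auto simp: \<M>_def)
qed

lemma BS3_imp_BS1:
  assumes "BS3 M P C"
  shows "BS1 M P C"
  unfolding BS1_def by (rule order_closed_integral_le[OF _ BS3_iff[THEN iffD1, OF assms]]) simp

text \<open>\<open>R\<close> consists of all supported probability measures. Every supported measure
  lies in the polar of the zero set, so an event null for all of \<open>R\<close> has an indicator
  meeting all constraints. By (BS3) this indicator is 0 in \<open>L0\<close>, and the event is
  polar.\<close>

lemma BS3_zero_imp_class_S:
  assumes BS3: "BS3 M P {L0_zero M P}"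
  shows "class_S M P"
proof -
  define R where "R = {Q \<in> prob_measures M. finite_ac Q \<and> (\<exists>S. support_of Q S)}"
  have R: "R \<subseteq> prob_measures M"
    by (auto simp: R_def)
  have "pol N" if N: "N \<in> sets M" and null: "\<And>Q. Q \<in> R \<Longrightarrow> emeasure Q N = 0" for N
  proof -
    \<comment> \<open>A nonzero supported finite measure is normalised to a member of
      \<open>R\<close>; scaling by a nonzero constant preserves null events and supports.\<close>
    have m_null: "emeasure m N = 0" if m: "finite_ac m" and S: "support_of m S" for m S
    proof (cases "emeasure m (space M) = 0")
      case True
      then show ?thesis
        using emeasure_space[of m N] finite_acD(3)[OF m] by simp
    next
      case False
      interpret finite_measure m
        using finite_acD(1)[OF m] .
      define c where "c = inverse (emeasure m (space M))"
      have fin: "emeasure m (space M) < top"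
        using finite_acD(3)[OF m] by (simp add: less_top[symmetric] emeasure_eq_measure)
      have c: "c \<noteq> 0"
        using fin by (auto simp: c_def)
      define Q where "Q = scale_measure c m"
      have Q: "sets Q = sets M" "space Q = space M"
        using finite_acD[OF m] by (simp_all add: Q_def space_scale_measure)
      have em: "emeasure Q A = c * emeasure m A" for A
        by (simp add: Q_def)
      have "prob_space Q"
        using ennreal_divide_self[OF False fin]
        by (intro prob_spaceI) (simp add: Q em c_def divide_ennreal_def mult.commute)
      then interpret Q: prob_space Q .
      have "finite_ac Q"
        using finite_acD(4)[OF m] Q Q.finite_measure_axioms by (auto simp: finite_ac_def em)
      moreover have "support_of Q S"
        using S c by (simp add: support_of_def em)
      ultimately have "emeasure Q N = 0"
        using null \<open>prob_space Q\<close> Q by (auto simp: R_def prob_measures_def)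
      with c show ?thesis
        by (simp add: em)
    qed
    have i: "(indicator N :: 'a \<Rightarrow> real) \<in> borel_measurable M"
      using N by simp
    have "cls (indicator N) \<in> {L0_zero M P}"
    proof (subst BS3[unfolded BS3_iff], intro CollectI conjI ballI)
      show "cls (indicator N) \<in> L0_pos M P"
        using i by (auto simp: cls_in_L0_pos intro: quasi_surelyI)
      fix m assume "m \<in> {m. finite_ac m \<and> (\<exists>S. support_of m S) \<and>
        (\<forall>X\<in>{L0_zero M P}. L0_integral M (measure m) X \<le> 1)}"
      then have m: "finite_ac m" "emeasure m N = 0"
        using m_null by auto
      have "(\<integral>\<^sup>+ w. ennreal (indicator N w) \<partial>m) = emeasure m N"
        using N finite_acD(2)[OF m(1)] by (simp add: ennreal_indicator)
      then show "L0_integral M (measure m) (cls (indicator N)) \<le> 1"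
        using m by (simp add: L0_integral_measure[OF m(1) i])
    qed
    then have "L0_le M P (cls (indicator N)) (L0_zero M P)"
      using i by (simp add: L0_le_refl L0_zero_def cls_in_L0)
    then have "qs (\<lambda>w. indicator N w \<le> (0::real))"
      using i by (simp add: L0_zero_def L0_le_cls)
    then show ?thesis
      using N by (rule qs_pol) auto
  qed
  then have "abs_cont M (measure ` P) (measure ` R)"
    using SUP_total_variation[OF R] SUP_total_variation[OF P] by (auto simp: abs_cont_def pol_iff)
  moreover have "abs_cont M (measure ` R) (measure ` P)"
    unfolding abs_cont_def
  proof (intro ballI impI)
    fix N assume N: "N \<in> sets M" "(SUP \<nu>\<in>measure ` P. total_variation M \<nu> N) = 0"
    then have "pol N"
      using SUP_total_variation[OF P N(1)] by (simp add: pol_iff)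
    then show "(SUP \<nu>\<in>measure ` R. total_variation M \<nu> N) = 0"
      unfolding SUP_total_variation[OF R N(1)] using finite_acD(4) by (auto simp: R_def)
  qed
  moreover have "measure ` R \<subseteq> sca_c M P"
    using measure_in_sca_c_iff by (auto simp: R_def)
  ultimately show ?thesis
    using R unfolding class_S_def equiv_cont_def by blast
qed


text \<open>For order closedness: if the constant net 0 converges to \<open>L\<close>, then the
  modulus of \<open>L\<close> is a lower bound of the dominating net, whose infimum is 0.\<close>

lemma zero_cone:
  shows "L0_convex M P {L0_zero M P}" "L0_solid M P {L0_zero M P}" "order_closed M P {L0_zero M P}"
    "{L0_zero M P} \<subseteq> L0_pos M P"
proof -
  have antisym: "cls f = L0_zero M P" if "f \<in> borel_measurable M" "qs (\<lambda>w. 0 \<le> f w)" "qs (\<lambda>w. f w \<le> 0)" for f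
    unfolding L0_zero_def
    by (rule cls_eqI) (use that in \<open>auto intro: qs_mp2[OF that(2,3)]\<close>)
  show "{L0_zero M P} \<subseteq> L0_pos M P"
    by (auto simp: L0_zero_def cls_in_L0_pos intro: quasi_surelyI)
  show "L0_convex M P {L0_zero M P}"
    by (auto simp: L0_convex_def L0_zero_def L0_scale_class[OF P] L0_add_class[OF P])
  show "L0_solid M P {L0_zero M P}"
    unfolding L0_solid_def
  proof (intro ballI impI)
    fix X Y assume X: "X \<in> {L0_zero M P}" and Y: "Y \<in> L0 M P" "L0_le M P (L0_zero M P) Y" "L0_le M P Y X"
    obtain f where f: "f \<in> borel_measurable M" "Y = cls f"
      using Y(1) by (rule L0_rep)
    then show "Y \<in> {L0_zero M P}"
      using X Y antisym[OF f(1)] by (simp add: L0_zero_def L0_le_cls)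
  qed
  show "order_closed M P {L0_zero M P}"
    unfolding order_closed_def
  proof (intro allI impI)
    fix I :: "('a \<Rightarrow> real) set set" and r X L
    assume dir: "directed_set I r" and X: "\<forall>a\<in>I. X a \<in> {L0_zero M P}"
      and conv: "order_converges M P I r X L"
    obtain Y where Y: "decreases_to_zero M P I r Y"
      and le: "\<forall>a\<in>I. L0_le M P (L0_abs M P (L0_diff M P (X a) L)) (Y a)" and L: "L \<in> L0 M P"
      using conv by (auto simp: order_converges_def)
    obtain l where l [measurable]: "l \<in> borel_measurable M" and Ll: "L = cls l"
      using L by (rule L0_rep)
    have eq: "L0_abs M P (L0_diff M P (L0_zero M P) L) = cls (\<lambda>w. \<bar>l w\<bar>)"
      by (simp add: Ll L0_zero_def L0_diff_cls L0_abs_class[OF P])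
    have "\<forall>a\<in>I. L0_le M P (cls (\<lambda>w. \<bar>l w\<bar>)) (Y a)"
      using le X eq by auto
    then have "L0_le M P (cls (\<lambda>w. \<bar>l w\<bar>)) (L0_zero M P)"
      using Y by (simp add: decreases_to_zero_def cls_in_L0)
    then have "qs (\<lambda>w. \<bar>l w\<bar> \<le> 0)"
      by (simp add: L0_zero_def L0_le_cls)
    then have "qs (\<lambda>w. 0 \<le> l w)" "qs (\<lambda>w. l w \<le> 0)"
      by (auto elim: qs_mp)
    then show "L \<in> {L0_zero M P}"
      using antisym[OF l] by (simp add: Ll)
  qed
qed

section \<open>Supports obtained from order closed integral balls\<close>

text \<open>These are the test sets for the second equivalence. (BS2) is immediate because
  \<open>measure m\<close> itself belongs to the polar of \<open>C\<close>.\<close>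

lemma integral_ball:
  assumes m: "finite_ac m"
  defines "C \<equiv> {X\<in>L0_pos M P. L0_integral M (measure m) X \<le> 1}"
  shows "L0_zero M P \<in> C" "L0_convex M P C" "L0_solid M P C" "BS2 M P C"
proof -
  note meas_m = measurable_finite_ac[OF m]
  have C_iff: "cls f \<in> C \<longleftrightarrow> qs (\<lambda>w. 0 \<le> f w) \<and> (\<integral>\<^sup>+ w. ennreal (f w) \<partial>m) \<le> 1"
    if "f \<in> borel_measurable M" for f
    using that by (simp add: C_def cls_in_L0_pos L0_integral_measure[OF m])
  show "L0_zero M P \<in> C"
    by (simp add: L0_zero_def C_iff quasi_surelyI)
  show "L0_convex M P C"
    unfolding L0_convex_def
  proof (intro ballI allI impI)
    fix X Y and t :: real assume XY: "X \<in> C" "Y \<in> C" and t: "0 \<le> t" "t \<le> 1"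
    have "X \<in> L0_pos M P" "Y \<in> L0_pos M P"
      using XY by (auto simp: C_def)
    then obtain f g where f: "f \<in> borel_measurable M" "\<forall>w. 0 \<le> f w" "X = cls f"
      and g: "g \<in> borel_measurable M" "\<forall>w. 0 \<le> g w" "Y = cls g"
      by (metis L0_pos_repE)
    note [measurable] = f(1) g(1)
    have [measurable]: "f \<in> borel_measurable m" "g \<in> borel_measurable m"
      by (simp_all add: meas_m f g)
    have le: "(\<integral>\<^sup>+ w. ennreal (f w) \<partial>m) \<le> 1" "(\<integral>\<^sup>+ w. ennreal (g w) \<partial>m) \<le> 1"
      using XY f g by (simp_all add: C_iff)
    have "(\<integral>\<^sup>+ w. ennreal (t * f w + (1 - t) * g w) \<partial>m)
        = (\<integral>\<^sup>+ w. ennreal t * ennreal (f w) + ennreal (1 - t) * ennreal (g w) \<partial>m)"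
      using f g t by (intro nn_integral_cong) (simp add: ennreal_plus ennreal_mult)
    also have "\<dots> = ennreal t * (\<integral>\<^sup>+ w. ennreal (f w) \<partial>m) + ennreal (1 - t) * (\<integral>\<^sup>+ w. ennreal (g w) \<partial>m)"
      by (simp add: nn_integral_add nn_integral_cmult)
    also have "\<dots> \<le> ennreal t * 1 + ennreal (1 - t) * 1"
      using le by (intro add_mono mult_left_mono) auto
    also have "\<dots> = 1"
      using t by (simp flip: ennreal_plus)
    finally have "cls (\<lambda>w. t * f w + (1 - t) * g w) \<in> C"
      using f g t by (subst C_iff) (auto intro!: quasi_surelyI)
    then show "L0_add M P (L0_scale M P t X) (L0_scale M P (1 - t) Y) \<in> C"
      by (simp add: f(3) g(3) L0_scale_class[OF P] L0_add_class[OF P])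
  qed
  show "L0_solid M P C"
    unfolding L0_solid_def
  proof (intro ballI impI)
    fix X Y assume X: "X \<in> C" and Y: "Y \<in> L0 M P" "L0_le M P (L0_zero M P) Y" "L0_le M P Y X"
    have "X \<in> L0 M P"
      using X by (simp add: C_def L0_pos_def)
    then obtain f where f: "f \<in> borel_measurable M" "X = cls f"
      by (rule L0_rep)
    obtain g where g: "g \<in> borel_measurable M" "Y = cls g"
      using Y(1) by (rule L0_rep)
    have "qs (\<lambda>w. g w \<le> f w)"
      using Y(3) f g by (simp add: L0_le_cls)
    then have "AE w in m. g w \<le> f w"
      by (rule qs_AE[OF m])
    then have "(\<integral>\<^sup>+ w. ennreal (g w) \<partial>m) \<le> (\<integral>\<^sup>+ w. ennreal (f w) \<partial>m)"
      by (intro nn_integral_mono_AE) (auto elim!: eventually_mono intro: ennreal_leI)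
    then show "Y \<in> C"
      using X Y(2) f g by (simp add: C_iff L0_zero_le_cls) (metis order_trans)
  qed
  show "BS2 M P C"
    unfolding BS2_iff using m by (auto simp: C_def)
qed

text \<open>Otherwise every non-polar event contains a non-polar \<open>m\<close>-null one. Then
  only functions that are quasi surely at least \<open>K\<close> dominate all
  \<open>K * indicator B\<close> with \<open>B\<close> null. So these functions, whose integrals are
  0, increase to the constant \<open>K\<close>, and order closedness would put \<open>K\<close> into
  the ball.\<close>

lemma locally_supported:
  assumes BS: "\<forall>C. C \<noteq> {} \<longrightarrow> C \<subseteq> L0_pos M P \<longrightarrow> L0_convex M P C \<longrightarrow> L0_solid M P C \<longrightarrow>
      BS2 M P C \<longrightarrow> BS1 M P C"
    and m: "finite_ac m" and nonzero: "emeasure m (space M) \<noteq> 0"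
  shows "\<exists>A\<in>sets M. \<not> pol A \<and> (\<forall>N\<in>sets M. N \<subseteq> A \<longrightarrow> emeasure m N = 0 \<longrightarrow> pol N)"
proof (rule ccontr)
  assume no: "\<not> ?thesis"
  have rich: "\<exists>N\<in>sets M. N \<subseteq> A \<and> emeasure m N = 0 \<and> \<not> pol N" if "A \<in> sets M" "\<not> pol A" for A
    using no that by blast
  interpret finite_measure m
    using finite_acD(1)[OF m] .
  define C where "C = {X\<in>L0_pos M P. L0_integral M (measure m) X \<le> 1}"
  have "BS1 M P C"
    using integral_ball[OF m] by (intro BS[rule_format]) (auto simp: C_def)
  then have closed: "order_closed M P C"
    by (simp add: BS1_def)
  \<comment> \<open>This choice keeps the constant function \<open>K\<close> outside the
    ball.\<close>
  obtain K :: nat where K: "1 < real K * measure m (space M)"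
  proof -
    have "0 < measure m (space M)"
      using nonzero by (simp add: emeasure_eq_measure zero_less_measure_iff)
    then show ?thesis
      using reals_Archimedean3[of "measure m (space M)"] that by blast
  qed
  define I where "I = {B\<in>sets M. emeasure m B = 0}"
  have "cls (\<lambda>w. real K) \<in> C"
  proof (rule order_closed_SUP[OF closed, of I "{(A, B). A \<in> I \<and> B \<in> I \<and> A \<subseteq> B}"
        "\<lambda>B w. real K * indicator B w"])
    show "directed_set I {(A, B). A \<in> I \<and> B \<in> I \<and> A \<subseteq> B}"
      unfolding directed_set_def
    proof (intro conjI ballI)
      show "I \<noteq> {}"
        by (auto simp: I_def)
      show "preorder_on I {(A, B). A \<in> I \<and> B \<in> I \<and> A \<subseteq> B}"
        by (auto simp: preorder_on_def refl_on_def trans_def)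
      fix A B assume AB: "A \<in> I" "B \<in> I"
      then have "A \<in> null_sets m" "B \<in> null_sets m"
        using finite_acD(2)[OF m] by (auto simp: I_def null_sets_def)
      then have "A \<union> B \<in> null_sets m"
        by (rule null_sets.Un)
      then have "A \<union> B \<in> I"
        using finite_acD(2)[OF m] by (auto simp: I_def null_sets_def)
      with AB show "\<exists>U\<in>I. (A, U) \<in> {(A, B). A \<in> I \<and> B \<in> I \<and> A \<subseteq> B} \<and>
          (B, U) \<in> {(A, B). A \<in> I \<and> B \<in> I \<and> A \<subseteq> B}"
        by (intro bexI[of _ "A \<union> B"]) auto
    qed
  next
    fix B assume B: "B \<in> I"
    then have [measurable]: "B \<in> sets M"
      by (simp add: I_def)
    show meas: "(\<lambda>w. real K * indicator B w) \<in> borel_measurable M"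
      by measurable
    show "qs (\<lambda>w. real K * indicator B w \<le> real K)"
      by (intro quasi_surelyI) (auto simp: indicator_def)
    have "B \<in> null_sets m"
      using B finite_acD(2)[OF m] by (auto simp: I_def null_sets_def)
    then have "(\<integral>\<^sup>+ w. ennreal (real K * indicator B w) \<partial>m) = (\<integral>\<^sup>+ w. 0 \<partial>m)"
      by (intro nn_integral_cong_AE eventually_mono[OF AE_not_in]) auto
    then show "cls (\<lambda>w. real K * indicator B w) \<in> C"
      using meas by (auto simp: C_def cls_in_L0_pos L0_integral_measure[OF m] intro!: quasi_surelyI)
  next
    fix A B assume "(A, B) \<in> {(A, B). A \<in> I \<and> B \<in> I \<and> A \<subseteq> B}"
    then show "qs (\<lambda>w. real K * indicator A w \<le> real K * indicator B w)"
      by (intro quasi_surelyI) (auto simp: indicator_def)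
  next
    fix z :: "'a \<Rightarrow> real"
    assume z [measurable]: "z \<in> borel_measurable M"
      and upper: "\<And>B. B \<in> I \<Longrightarrow> qs (\<lambda>w. real K * indicator B w \<le> z w)"
    define A where "A = {w\<in>space M. z w < real K}"
    have [measurable]: "A \<in> sets M"
      unfolding A_def by measurable
    have "pol A"
    proof (rule ccontr)
      assume "\<not> pol A"
      then obtain N where N: "N \<in> sets M" "N \<subseteq> A" "emeasure m N = 0" "\<not> pol N"
        using rich[of A] by auto
      then have "qs (\<lambda>w. real K * indicator N w \<le> z w)"
        by (intro upper) (simp add: I_def)
      then have "pol N"
        by (rule qs_pol) (use N(1,2) in \<open>auto simp: A_def\<close>)
      with N(4) show False ..
    qed
    then show "qs (\<lambda>w. real K \<le> z w)"
      by (rule pol_qs) (auto simp: A_def)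
  qed simp
  then have "ennreal (real K) * emeasure m (space M) \<le> 1"
    using finite_acD(3)[OF m] by (simp add: C_def L0_integral_measure[OF m])
  then have "ennreal (real K * measure m (space M)) \<le> 1"
    by (simp add: emeasure_eq_measure ennreal_mult)
  with K show False
    by simp
qed

text \<open>Exhaustion over the class \<open>\<A>\<close> of events whose null subevents are polar.
  A member \<open>S\<close> of maximal measure must carry \<open>m\<close>; otherwise
  \<open>locally_supported\<close>, applied to the restriction of \<open>m\<close> to the
  complement, provides a member of \<open>\<A>\<close> that enlarges it.\<close>

lemma exists_support:
  assumes BS: "\<forall>C. C \<noteq> {} \<longrightarrow> C \<subseteq> L0_pos M P \<longrightarrow> L0_convex M P C \<longrightarrow> L0_solid M P C \<longrightarrow>
      BS2 M P C \<longrightarrow> BS1 M P C"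
    and m: "finite_ac m"
  obtains S where "support_of m S"
proof -
  interpret finite_measure m
    using finite_acD(1)[OF m] .
  note [simp] = finite_acD(2,3)[OF m]
  define \<A> where "\<A> = {A\<in>sets M. \<forall>N\<in>sets M. N \<subseteq> A \<longrightarrow> emeasure m N = 0 \<longrightarrow> pol N}"
  have \<A>_UN: "(\<Union>n. A n) \<in> \<A>" if A: "\<And>n::nat. A n \<in> \<A>" for A
  proof -
    have "pol N" if N: "N \<in> sets M" "N \<subseteq> (\<Union>n. A n)" "emeasure m N = 0" for N
    proof -
      have "pol (N \<inter> A n)" for n
      proof -
        have "emeasure m (N \<inter> A n) \<le> emeasure m N"
          using N by (intro emeasure_mono) auto
        then show ?thesis
          using A[of n] N by (auto simp: \<A>_def)
      qed
      then have "pol (\<Union>n. N \<inter> A n)"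
        by (rule pol_UN)
      moreover have "(\<Union>n. N \<inter> A n) = N"
        using N(2) by auto
      ultimately show ?thesis
        by simp
    qed
    moreover have "(\<Union>n. A n) \<in> sets M"
      using A by (intro sets.countable_UN) (auto simp: \<A>_def)
    ultimately show ?thesis
      by (auto simp: \<A>_def)
  qed
  have "{} \<in> \<A>"
    by (auto simp: \<A>_def pol_iff)
  define s where "s = (SUP A\<in>\<A>. measure m A)"
  have bdd: "bdd_above (measure m ` \<A>)"
    by (intro bdd_aboveI2[of _ _ "measure m (space m)"] bounded_measure)
  have le_s: "measure m A \<le> s" if "A \<in> \<A>" for A
    unfolding s_def using that bdd by (rule cSUP_upper)
  have "\<exists>A\<in>\<A>. s - 1 / real (Suc n) < measure m A" for n
    using less_cSUP_iff[OF _ bdd, of "s - 1 / real (Suc n)"] \<open>{} \<in> \<A>\<close> by (auto simp: s_def)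
  then obtain A where A: "\<And>n. A n \<in> \<A>" "\<And>n. s - 1 / real (Suc n) < measure m (A n)"
    by metis
  define S where "S = (\<Union>n. A n)"
  have S: "S \<in> \<A>"
    unfolding S_def by (rule \<A>_UN[OF A(1)])
  then have SM [measurable]: "S \<in> sets M"
    by (simp add: \<A>_def)
  have s_le: "s \<le> measure m S"
  proof (rule field_le_epsilon)
    fix e :: real assume "0 < e"
    then obtain n where n: "1 / real (Suc n) < e"
      using nat_approx_posE by blast
    have "measure m (A n) \<le> measure m S"
      using SM by (intro finite_measure_mono) (auto simp: S_def)
    with A(2)[of n] n show "s \<le> measure m S + e"
      by linarith
  qed
  have "emeasure m (space M - S) = 0"
  proof (rule ccontr)
    assume ne: "emeasure m (space M - S) \<noteq> 0"
    \<comment> \<open>The restriction of \<open>m\<close> to the complement of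
      \<open>S\<close>.\<close>
    define m' where "m' = density m (indicator (space M - S))"
    have em': "emeasure m' B = emeasure m (B - S)" if B: "B \<in> sets M" for B
    proof -
      have "emeasure m' B = (\<integral>\<^sup>+ w. indicator (space M - S) w * indicator B w \<partial>m)"
        unfolding m'_def using B SM by (intro emeasure_density borel_measurable_indicator) auto
      also have "\<dots> = (\<integral>\<^sup>+ w. indicator ((space M - S) \<inter> B) w \<partial>m)"
        by (simp add: indicator_inter_arith)
      also have "\<dots> = emeasure m ((space M - S) \<inter> B)"
        using B SM by (intro nn_integral_indicator) auto
      also have "(space M - S) \<inter> B = B - S"
        using sets.sets_into_space[OF B] by auto
      finally show ?thesis .
    qed
    have m': "finite_ac m'"
      unfolding finite_ac_def
    proof (intro conjI allI impI)
      show "sets m' = sets M"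
        by (simp add: m'_def)
      then have "space m' = space M"
        by (rule sets_eq_imp_space_eq)
      then show "finite_measure m'"
        by (intro finite_measureI) (simp add: em')
      fix N assume N: "pol N"
      then have "emeasure m (N - S) \<le> emeasure m N"
        by (intro emeasure_mono) (auto simp: pol_iff)
      then show "emeasure m' N = 0"
        using N finite_acD(4)[OF m N] by (simp add: em' pol_iff)
    qed
    obtain B where B: "B \<in> sets M" "\<not> pol B"
      and B_supp: "\<And>N. N \<in> sets M \<Longrightarrow> N \<subseteq> B \<Longrightarrow> emeasure m' N = 0 \<Longrightarrow> pol N"
      using locally_supported[OF BS m'] ne em'[of "space M"] by (metis sets.top)
    \<comment> \<open>\<open>m'\<close> vanishes on \<open>S\<close>. As \<open>B\<close> is not
      polar, its part outside \<open>S\<close> must be non-polar and hence have positive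
      measure.\<close>
    have "pol (B \<inter> S)"
      using B(1) SM by (intro B_supp) (auto simp: em' Diff_eq Int_assoc)
    have BS_\<A>: "B - S \<in> \<A>"
      unfolding \<A>_def
    proof (intro CollectI conjI ballI impI)
      fix N assume N: "N \<in> sets M" "N \<subseteq> B - S" "emeasure m N = 0"
      then have "N - S = N"
        by auto
      with N show "pol N"
        by (intro B_supp) (auto simp: em')
    qed (use B(1) in auto)
    have "measure m (B - S) \<noteq> 0"
    proof
      assume "measure m (B - S) = 0"
      then have "pol (B - S)"
        using BS_\<A> by (auto simp: \<A>_def emeasure_eq_measure)
      with \<open>pol (B \<inter> S)\<close> have "pol (B \<inter> S \<union> (B - S))"
        by (intro polar_event_Un[OF P])
      with B(2) show False
        by (simp add: Int_Diff_Un)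
    qed
    moreover have "S \<union> (B - S) \<in> \<A>"
    proof -
      have "(\<Union>n. case n of 0 \<Rightarrow> B - S | Suc k \<Rightarrow> A k) \<in> \<A>"
        using A(1) BS_\<A> by (intro \<A>_UN) (auto split: nat.split)
      moreover have "(\<Union>n. case n of 0 \<Rightarrow> B - S | Suc k \<Rightarrow> A k) = S \<union> (B - S)"
        by (subst UNIV_nat_eq) (simp add: image_image S_def Un_commute)
      ultimately show ?thesis
        by simp
    qed
    then have "measure m S + measure m (B - S) \<le> s"
      using le_s[of "S \<union> (B - S)"] B(1) SM by (subst (asm) finite_measure_Union) auto
    ultimately show False
      using s_le measure_nonneg[of m "B - S"] by linarith
  qed
  then have "support_of m S"
    using S by (simp add: support_of_def \<A>_def)
  then show ?thesis
    by (rule that)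
qed

text \<open>\<open>m\<close> is \<open>\<bar>\<mu>\<bar>\<close>, but \<open>supported\<close> depends on the null sets only, so equality is not needed.\<close>

lemma ca_c_variation:
  assumes \<mu>: "\<mu> \<in> ca_c M P"
  obtains m where "finite_ac m" "\<And>A. A \<in> sets M \<Longrightarrow> total_variation M \<mu> A = 0 \<longleftrightarrow> emeasure m A = 0"
proof -
  have ca: "\<mu> \<in> ca M" and null: "\<And>N. pol N \<Longrightarrow> \<mu> N = 0"
    using \<mu> by (auto simp: ca_c_iff)
  obtain H where H: "H \<in> sets M" "\<forall>A\<in>sets M. A \<subseteq> H \<longrightarrow> 0 \<le> \<mu> A"
    "\<forall>A\<in>sets M. A \<inter> H = {} \<longrightarrow> \<mu> A \<le> 0"
    using ca_Hahn_decomposition[OF ca] by blast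
  \<comment> \<open>The variation by the Hahn decomposition, set to 0 on nonmeasurable sets as
    membership in \<open>ca\<close> demands.\<close>
  define \<nu> where "\<nu> A = (if A \<in> sets M then \<mu> (A \<inter> H) - \<mu> (A - H) else 0)" for A
  have pos: "0 \<le> \<mu> (A \<inter> H)" "\<mu> (A - H) \<le> 0" if "A \<in> sets M" for A
    using H that by auto
  have "\<nu> \<in> ca M"
    unfolding ca_def
  proof (intro CollectI conjI allI impI)
    fix A :: "nat \<Rightarrow> 'a set"
    assume A: "range A \<subseteq> sets M" "disjoint_family A"
    have "(\<lambda>i. \<mu> (A i \<inter> H)) sums \<mu> (\<Union>i. A i \<inter> H)"
      using A H(1) by (intro ca_sums[OF ca]) (auto simp: disjoint_family_on_def)
    moreover have "(\<lambda>i. \<mu> (A i - H)) sums \<mu> (\<Union>i. A i - H)"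
      using A H(1) by (intro ca_sums[OF ca]) (auto simp: disjoint_family_on_def)
    ultimately have "(\<lambda>i. \<mu> (A i \<inter> H) - \<mu> (A i - H)) sums (\<mu> (\<Union>i. A i \<inter> H) - \<mu> (\<Union>i. A i - H))"
      by (rule sums_diff)
    moreover have "(\<Union>i. A i \<inter> H) = (\<Union>i. A i) \<inter> H" "(\<Union>i. A i - H) = (\<Union>i. A i) - H"
      by auto
    moreover have "A i \<in> sets M" for i
      using A(1) by auto
    moreover from this have "(\<Union>i. A i) \<in> sets M"
      by auto
    ultimately show "(\<lambda>i. \<nu> (A i)) sums \<nu> (\<Union>i. A i)"
      by (simp add: \<nu>_def)
  qed (simp add: \<nu>_def)
  moreover have "\<nu> N = 0" if "pol N" for N
  proof -
    have "pol (N \<inter> H)" "pol (N - H)"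
      using that H(1) by (auto simp: pol_iff intro: pol_subset[OF that, unfolded pol_iff, THEN conjunct2, rule_format])
    then show ?thesis
      using null by (simp add: \<nu>_def)
  qed
  ultimately have \<nu>: "\<nu> \<in> ca_c_pos M P"
    using pos by (auto simp: ca_c_pos_def ca_c_iff \<nu>_def intro: order_trans)
  show ?thesis
  proof (rule that[OF finite_ac_ca_measure(1)[OF \<nu>]])
    fix A assume A: "A \<in> sets M"
    have "emeasure (ca_measure M \<nu>) A = ennreal (\<nu> A)"
      using \<nu> A by (intro emeasure_ca_measure) (auto simp: ca_c_pos_def ca_c_def)
    moreover have "ennreal (\<nu> A) = 0 \<longleftrightarrow> \<mu> (A \<inter> H) = 0 \<and> \<mu> (A - H) = 0"
      using pos[OF A] A by (auto simp: \<nu>_def ennreal_eq_0_iff)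
    \<comment> \<open>On each side of \<open>H\<close> the values have one sign. If the value of the
      whole part is 0, additivity therefore forces both its pieces, inside \<open>B\<close> and
      outside \<open>B\<close>, to have value 0.\<close>
    moreover have "\<dots> \<longleftrightarrow> (\<forall>B\<in>sets M. B \<subseteq> A \<longrightarrow> \<mu> B = 0)"
    proof (intro iffI ballI impI)
      fix B assume z: "\<mu> (A \<inter> H) = 0 \<and> \<mu> (A - H) = 0" and B: "B \<in> sets M" "B \<subseteq> A"
      have "\<mu> (A \<inter> H) = \<mu> (B \<inter> H) + \<mu> ((A - B) \<inter> H)"
      proof -
        have "(A \<inter> H) \<inter> B = B \<inter> H" "A \<inter> H - B = (A - B) \<inter> H"
          using B(2) by auto
        then show ?thesis
          using ca_split[OF ca, of "A \<inter> H" B] A B(1) H(1) by simp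
      qed
      moreover have "\<mu> (A - H) = \<mu> (B - H) + \<mu> ((A - B) - H)"
      proof -
        have "(A - H) \<inter> B = B - H" "A - H - B = (A - B) - H"
          using B(2) by auto
        then show ?thesis
          using ca_split[OF ca, of "A - H" B] A B(1) H(1) by simp
      qed
      ultimately have "\<mu> (B \<inter> H) = 0" "\<mu> (B - H) = 0"
        using z pos[OF B(1)] pos[of "A - B"] A B(1) by (auto simp: sets.Diff)
      then show "\<mu> B = 0"
        using ca_split[OF ca B(1) H(1)] by simp
    qed (use A H(1) in auto)
    ultimately show "total_variation M \<mu> A = 0 \<longleftrightarrow> emeasure (ca_measure M \<nu>) A = 0"
      using total_variation_eq_0_iff[OF ca A] by simp
  qed
qed

section \<open>The two characterisations\<close>

text \<open>For the converse a single test set suffices: the zero set is convex, solid and order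
  closed, so it satisfies (BS3).\<close>

lemma class_S_iff:
  "class_S M P \<longleftrightarrow> (\<forall>C. C \<noteq> {} \<longrightarrow> C \<subseteq> L0_pos M P \<longrightarrow> L0_convex M P C \<longrightarrow> L0_solid M P C \<longrightarrow>
    (BS1 M P C \<longleftrightarrow> BS3 M P C))"
proof
  assume "class_S M P"
  then show "\<forall>C. C \<noteq> {} \<longrightarrow> C \<subseteq> L0_pos M P \<longrightarrow> L0_convex M P C \<longrightarrow> L0_solid M P C \<longrightarrow>
      (BS1 M P C \<longleftrightarrow> BS3 M P C)"
    using class_S_imp_BS3 BS3_imp_BS1 by (auto simp: BS1_def)
next
  assume "\<forall>C. C \<noteq> {} \<longrightarrow> C \<subseteq> L0_pos M P \<longrightarrow> L0_convex M P C \<longrightarrow> L0_solid M P C \<longrightarrow>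
      (BS1 M P C \<longleftrightarrow> BS3 M P C)"
  then have "BS3 M P {L0_zero M P}"
    using zero_cone by (simp add: BS1_def)
  then show "class_S M P"
    by (rule BS3_zero_imp_class_S)
qed

text \<open>If all measures are supported, \<open>P\<close> itself witnesses class (S) and (BS2)
  coincides with (BS3), so \<open>class_S_iff\<close> applies. Conversely, a signed measure is
  replaced by a positive one with the null events of its variation, and
  \<open>exists_support\<close> supplies the support.\<close>

lemma sca_c_eq_ca_c_iff:
  "sca_c M P = ca_c M P \<longleftrightarrow> (\<forall>C. C \<noteq> {} \<longrightarrow> C \<subseteq> L0_pos M P \<longrightarrow> L0_convex M P C \<longrightarrow>
    L0_solid M P C \<longrightarrow> (BS1 M P C \<longleftrightarrow> BS2 M P C))"
proof
  assume eq: "sca_c M P = ca_c M P"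
  have "measure Q \<in> ca_c M P" if "Q \<in> P" for Q
    using measure_in_ca[of Q M] that P by (auto simp: ca_c_iff pol_iff measure_def)
  then have "measure ` P \<subseteq> sca_c M P"
    unfolding eq by auto
  then have "class_S M P"
    unfolding class_S_def using P by (intro exI[of _ P]) (auto simp: equiv_cont_def abs_cont_def)
  moreover have "polar M P C \<inter> sca_c M P = polar M P C" for C
    unfolding eq by (auto simp: polar_def ca_c_pos_def)
  then have "BS2 M P C \<longleftrightarrow> BS3 M P C" for C
    by (simp add: BS2_def BS3_def)
  ultimately show "\<forall>C. C \<noteq> {} \<longrightarrow> C \<subseteq> L0_pos M P \<longrightarrow> L0_convex M P C \<longrightarrow> L0_solid M P C \<longrightarrow>
      (BS1 M P C \<longleftrightarrow> BS2 M P C)"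
    by (simp add: class_S_iff)
next
  assume BS: "\<forall>C. C \<noteq> {} \<longrightarrow> C \<subseteq> L0_pos M P \<longrightarrow> L0_convex M P C \<longrightarrow> L0_solid M P C \<longrightarrow>
      (BS1 M P C \<longleftrightarrow> BS2 M P C)"
  have "\<mu> \<in> sca_c M P" if \<mu>: "\<mu> \<in> ca_c M P" for \<mu>
  proof -
    obtain m where m: "finite_ac m"
      "\<And>A. A \<in> sets M \<Longrightarrow> total_variation M \<mu> A = 0 \<longleftrightarrow> emeasure m A = 0"
      using ca_c_variation[OF \<mu>] by blast
    obtain S where "support_of m S"
      using exists_support[OF _ m(1)] BS by blast
    then show ?thesis
      using supported_iff[OF m] \<mu> by (auto simp: sca_c_def)
  qed
  then show "sca_c M P = ca_c M P"
    by (auto simp: sca_c_def)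
qed

end

theorem theorem4p2:
  fixes M :: "'a measure" and P :: "'a measure set"
  assumes "P \<subseteq> prob_measures M" and "P \<noteq> {}"
  shows "(class_S M P \<longleftrightarrow>
      (\<forall>C. C \<noteq> {} \<longrightarrow> C \<subseteq> L0_pos M P \<longrightarrow> L0_convex M P C \<longrightarrow> L0_solid M P C \<longrightarrow>
        (BS1 M P C \<longleftrightarrow> BS3 M P C)))
    \<and> (sca_c M P = ca_c M P \<longleftrightarrow>
      (\<forall>C. C \<noteq> {} \<longrightarrow> C \<subseteq> L0_pos M P \<longrightarrow> L0_convex M P C \<longrightarrow> L0_solid M P C \<longrightarrow>
        (BS1 M P C \<longleftrightarrow> BS2 M P C)))"
proof -
  interpret capacity_space M P
    using assms by unfold_locales
  show ?thesis
    using class_S_iff sca_c_eq_ca_c_iff by (rule conjI)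
qed

end
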